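(* Fix $\eta>0$ and $\epsilon\in(0,(\alpha+2)R]$. Suppose the Full-Information Algorithm with parameters $(\eta,\epsilon)$ described in the context is applied for $T$ rounds, let $\{\mathbf{f}_t\}_{t=1}^T\subseteq\mathcal{F}$ be the sequence of observed loss/payoff vectors, and let $\{\mathbf{s}_t\}_{t=1}^T$ be the sequence of points played by the algorithm. Then $$\mathbb{E}\left[\alpha\text{-regret}\left(\{(\mathbf{s}_t,\mathbf{f}_t)\}_{t=1}^T\right)\right]\le \frac{\alpha^2R^2}{T\eta}+\frac{\eta F^2}{2}+3F\epsilon ,$$ and the average number of calls to the approximation oracle $\mathcal{O}_{\mathcal{K}}$ of $\mathcal{K}$ per iteration is upper bounded by $$K(\eta,\epsilon):=O\left(\left(1+\frac{\eta\alpha RF+\eta^2F^2}{\epsilon^2}\right)d^2\ln\left(\frac{(\alpha+1)R}{\epsilon}\right)\right).$$ In particular, setting $\eta=\alpha RT^{-2/3}/F$, $\epsilon=\alpha RT^{-1/3}$ gives $$\mathbb{E}[\alpha\text{-regret}]=O\left(\alpha RFT^{-1/3}\right),\qquad K=O\left(d^2\ln\left(\frac{\alpha+1}{\alpha}T\right)\right).$$ Alternatively, setting $\eta=\alpha RT^{-1/2}/F$, $\epsilon=\alpha RT^{-1/2}$ gives $$\mathbb{E}[\alpha\text{-regret}]=O\left(\alpha RFT^{-1/2}\right),\qquad K=O\left(\sqrt{T}\,d^2\ln\left(\frac{\alpha+1}{\alpha}T\right)\right).$$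
   Context: Setting. $\|\cdot\|$ is the Euclidean norm on $\mathbb{R}^d$ and $\mathbb{R}^d_+$ is the non-negative orthant. $\mathcal{K},\mathcal{F}\subset\mathbb{R}^d_+$ are compact sets with $\max_{\mathbf{x}\in\mathcal{K}}\|\mathbf{x}\|\le R$, $\max_{\mathbf{f}\in\mathcal{F}}\|\mathbf{f}\|\le F$ for some $R,F>0$, and $0\le\mathbf{x}\cdot\mathbf{f}\le C$ for all $\mathbf{x}\in\mathcal{K},\mathbf{f}\in\mathcal{F}$, for some $C>0$. $\mathcal{K}$ is the set of feasible actions (it need not be convex) and $\mathcal{F}$ is the set of possible loss/payoff vectors. The parameter is $\alpha>0$: $\alpha\ge1$ corresponds to loss minimization and $\alpha<1$ to payoff maximization. Write $\alpha\mathcal{K}=\{\alpha\mathbf{x}:\mathbf{x}\in\mathcal{K}\}$ and $\mathrm{CH}$ for convex hull. The number of rounds $T$ is fixed and known in advance. The adversary is oblivious: $\mathbf{f}_1,\dots,\mathbf{f}_T$ are chosen before the first round and do not depend on the player's actions. Expectations are over the algorithm's randomness. Approximation oracle. A map $\mathcal{O}_{\mathcal{K}}:\mathbb{R}^d_+\to\mathcal{K}$ such that for all $\mathbf{c}\in\mathbb{R}^d_+$: $\mathcal{O}_{\mathcal{K}}(\mathbf{c})\cdot\mathbf{c}\le\alpha\min_{\mathbf{x}\in\mathcal{K}}\mathbf{x}\cdot\mathbf{c}$ if $\alpha\ge1$, and $\mathcal{O}_{\mathcal{K}}(\mathbf{c})\cdot\mathbf{c}\ge\alpha\max_{\mathbf{x}\in\mathcal{K}}\mathbf{x}\cdot\mathbf{c}$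 if $\alpha<1$. $\alpha$-regret. For $\mathbf{x}_t\in\mathcal{K}$, $\mathbf{f}_t\in\mathcal{F}$, $\alpha\text{-regret}(\{(\mathbf{x}_t,\mathbf{f}_t)\}_{t=1}^T)$ equals $\frac1T\sum_{t=1}^T\mathbf{x}_t\cdot\mathbf{f}_t-\alpha\min_{\mathbf{x}\in\mathcal{K}}\frac1T\sum_{t=1}^T\mathbf{x}\cdot\mathbf{f}_t$ if $\alpha\ge1$, and $\alpha\max_{\mathbf{x}\in\mathcal{K}}\frac1T\sum_{t=1}^T\mathbf{x}\cdot\mathbf{f}_t-\frac1T\sum_{t=1}^T\mathbf{x}_t\cdot\mathbf{f}_t$ if $\alpha<1$. Extended approximation oracle. For $\mathbf{c}\in\mathbb{R}^d$ write $\mathbf{c}=\mathbf{c}^++\mathbf{c}^-$, where $\mathbf{c}^+$ equals $\mathbf{c}$ on its non-negative coordinates and zero elsewhere, and $\mathbf{c}^-$ equals $\mathbf{c}$ on its negative coordinates and zero elsewhere. Let $\bar{\mathbf{v}}=\mathbf{v}/\|\mathbf{v}\|$ if $\|\mathbf{v}\|>0$ and $\bar{\mathbf{v}}=\mathbf{0}$ otherwise; $\bar{\mathbf{c}}^{\pm}$ is the normalization of $\mathbf{c}^{\pm}$. Define $\hat{\mathcal{O}}_{\mathcal{K}}(\mathbf{c})=(\mathbf{v},\mathbf{s})$ by $\mathbf{s}=\mathcal{O}_{\mathcal{K}}(\mathbf{c}^+)$, $\mathbf{v}=\mathbf{s}-\alpha R\,\bar{\mathbf{c}}^-$ if $\alpha\ge1$;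 and $\mathbf{s}=\mathcal{O}_{\mathcal{K}}(-\mathbf{c}^-)$, $\mathbf{v}=\mathbf{s}-R\,\bar{\mathbf{c}}^+$ if $\alpha<1$. Separation-or-Decomposition procedure with inputs $(\mathbf{x},\epsilon)$, $\mathbf{x}\in\mathbb{R}^d$. Let $N$ be a positive integer with $N\ge c\,d^2\ln\left(\frac{(\alpha+1)R+\|\mathbf{x}\|}{\epsilon}\right)$, where $c$ is a positive universal constant; $N$ is taken of this order, so that one call of the procedure makes $O\left(d^2\ln\left(\frac{(\alpha+1)R+\|\mathbf{x}\|}{\epsilon}\right)\right)$ oracle calls. Attempt to apply the Ellipsoid method for $N$ iterations to the feasibility problem: find $\mathbf{w}\in\mathbb{R}^d$ such that $(\mathbf{x}-\mathbf{z})\cdot\mathbf{w}\ge\epsilon$ for all $\mathbf{z}\in\alpha\mathcal{K}$ and $\|\mathbf{w}\|\le1$. Each iteration, with current iterate $\mathbf{w}$, applies the following consecutive steps: (1) $(\mathbf{v},\mathbf{s})\leftarrow\hat{\mathcal{O}}_{\mathcal{K}}(-\mathbf{w})$; if $(\mathbf{x}-\mathbf{v})\cdot\mathbf{w}<\epsilon$, use $\mathbf{v}-\mathbf{x}$ as a separating hyperplane for the Ellipsoid method and continue to the next iteration; (2) if $\|\mathbf{w}\|>1$, use $\mathbf{w}$ as a separating hyperplane for the Ellipsoid method and continue to the next iteration; (3) otherwise declare the problem feasible and return the vector $\mathbf{w}$ (a separating hyperplane). If $N$ iterations are completed without declaring feasibility, return the decomposition consisting of the outputs $(\mathbf{v}_1,\mathbf{s}_1),\dots,(\mathbf{v}_N,\mathbf{s}_N)$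 of the extended approximation oracle gathered during the run and an optimal solution $(a_1,\dots,a_N)$ of: minimize $\frac12\|\sum_{i=1}^Na_i\mathbf{v}_i-\mathbf{x}\|^2$ subject to $a_i\ge0$ for all $i$ and $\sum_{i=1}^Na_i=1$. Projection Algorithm ((infeasible) projection onto $\mathrm{CH}(\alpha\mathcal{K})$) with inputs $(\mathbf{y},\epsilon)$. Set $\tilde{\mathbf{y}}\leftarrow\mathbf{y}/\max\{1,\|\mathbf{y}\|/(\alpha R)\}$. Repeat: call the Separation-or-Decomposition procedure with inputs $(\tilde{\mathbf{y}},\epsilon)$; if it outputs a separating hyperplane $\mathbf{w}$, set $\tilde{\mathbf{y}}\leftarrow\tilde{\mathbf{y}}-\epsilon\mathbf{w}$; otherwise stop and return $\tilde{\mathbf{y}}$, $(a_1,\dots,a_N)$ and $\{(\mathbf{v}_1,\mathbf{s}_1),\dots,(\mathbf{v}_N,\mathbf{s}_N)\}$. Full-Information Algorithm with learning rate $\eta>0$ and projection error parameter $\epsilon>0$. Let $\mathbf{s}_1$ be some point in $\mathcal{K}$ and set $\tilde{\mathbf{y}}_1=\alpha\mathbf{s}_1$. For $t=1,\dots,T$: play $\mathbf{s}_t$; receive the loss/payoff vector $\mathbf{f}_t\in\mathcal{F}$; set $\mathbf{y}_{t+1}=\tilde{\mathbf{y}}_t-\eta\mathbf{f}_t$ if $\alpha\ge1$ and $\mathbf{y}_{t+1}=\tilde{\mathbf{y}}_t+\eta\mathbf{f}_t$ if $\alpha<1$; call the Projection Algorithm with inputs $(\mathbf{y}_{t+1},\epsilon)$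 to obtain $\tilde{\mathbf{y}}_{t+1}$, a distribution $(a_1,\dots,a_N)$ and pairs $\{(\mathbf{v}_1,\mathbf{s}_1),\dots,(\mathbf{v}_N,\mathbf{s}_N)\}\subseteq\mathbb{R}^d\times\mathcal{K}$; sample the next play $\mathbf{s}_{t+1}$ from the points $\mathbf{s}_1,\dots,\mathbf{s}_N$ of these returned pairs according to the distribution $(a_1,\dots,a_N)$.
   Formalization: In the oracle-call bounds each logarithm is replaced by its maximum with 1: as written the bound is 0 or negative for ε ≥ (α+1)R (and tends to 0 at T = 1 for large α), although each round makes at least one oracle call. *)

theory Defs
  imports "HOL-Probability.Probability"
begin

text \<open>
  The ambient space is \<^typ>\<open>real ^ 'n\<close>, of dimension \<open>d = CARD('n)\<close>. Rounds are numbered from 0, so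
  the action and the vector of round \<open>t + 1\<close> of the usual presentation are \<open>s t\<close> and \<open>f t\<close>.

  Since the dimension is a type parameter, a constant under an existential quantifier could depend
  on it. Universal constants (those hidden in O-notation, and the one in the number of ellipsoid
  iterations) are therefore given as explicit numerals.
\<close>

definition nonneg_orthant :: "(real ^ 'n) set" where
  "nonneg_orthant = {x. \<forall>i. 0 \<le> x $ i}"

text \<open>
  In the next two definitions \<open>\<K>\<close> is meant to be compact and nonempty, so that the infima and
  suprema of linear functionals over it are attained.
\<close>

definition approx_oracle ::
    "real \<Rightarrow> (real ^ 'n) set \<Rightarrow> (real ^ 'n \<Rightarrow> real ^ 'n) \<Rightarrow> bool" where
  "approx_oracle \<alpha> \<K> \<O> \<longleftrightarrow>
     (\<forall>c \<in> nonneg_orthant.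
        \<O> c \<in> \<K> \<and>
        (if \<alpha> \<ge> 1 then \<O> c \<bullet> c \<le> \<alpha> * (INF x\<in>\<K>. x \<bullet> c)
         else \<O> c \<bullet> c \<ge> \<alpha> * (SUP x\<in>\<K>. x \<bullet> c)))"

definition alpha_regret ::
    "real \<Rightarrow> (real ^ 'n) set \<Rightarrow> nat \<Rightarrow> (nat \<Rightarrow> real ^ 'n) \<Rightarrow> (nat \<Rightarrow> real ^ 'n) \<Rightarrow> real" where
  "alpha_regret \<alpha> \<K> T s f =
     (if \<alpha> \<ge> 1
      then 1 / real T * (\<Sum>t<T. s t \<bullet> f t) - \<alpha> * (INF x\<in>\<K>. 1 / real T * (\<Sum>t<T. x \<bullet> f t))
      else \<alpha> * (SUP x\<in>\<K>. 1 / real T * (\<Sum>t<T. x \<bullet> f t)) - 1 / real T * (\<Sum>t<T. s t \<bullet> f t))"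

definition pos_part :: "real ^ 'n \<Rightarrow> real ^ 'n" where
  "pos_part c = (\<chi> i. max 0 (c $ i))"

definition neg_part :: "real ^ 'n \<Rightarrow> real ^ 'n" where
  "neg_part c = (\<chi> i. min 0 (c $ i))"

text \<open>
  The parts satisfy \<open>c = pos_part c + neg_part c\<close>, so \<open>neg_part c \<le> 0\<close> (no sign change).
  The normalization \<open>v / norm v\<close>, with value 0 at 0, is \<^const>\<open>sgn\<close>.
\<close>

definition extended_oracle ::
    "real \<Rightarrow> real \<Rightarrow> (real ^ 'n \<Rightarrow> real ^ 'n) \<Rightarrow> real ^ 'n \<Rightarrow> (real ^ 'n) \<times> (real ^ 'n)" where
  "extended_oracle \<alpha> R \<O> c =
     (if \<alpha> \<ge> 1
      then (let s = \<O> (pos_part c) in (s - (\<alpha> * R) *\<^sub>R sgn (neg_part c), s))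
      else (let s = \<O> (- neg_part c) in (s - R *\<^sub>R sgn (pos_part c), s)))"

text \<open>
  Central-cut ellipsoid update. A pair \<open>(w, A)\<close> stands for the ellipsoid
  \<open>{z. (z - w) \<bullet> A\<inverse> (z - w) \<le> 1}\<close>, and the result is the least-volume ellipsoid containing its half
  \<open>{z. g \<bullet> z \<le> g \<bullet> w}\<close>. The usual textbook form of the new matrix is
  \<open>d\<^sup>2 / (d\<^sup>2 - 1) (A - 2 / (d + 1) b b\<^sup>T)\<close>; it is split here into the component along \<open>b\<close>, with factor
  \<open>d\<^sup>2 / (d\<^sup>2 - 1) (1 - 2 / (d + 1)) = (d / (d + 1))\<^sup>2\<close>, and the rest. For \<open>d = 1\<close> the rest vanishes
  and the formula gives \<open>A / 4\<close>, i.e. bisection.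
  For \<open>g = 0\<close>, which is not a hyperplane, \<open>b = 0\<close> and the center does not move.
\<close>

definition ellipsoid_step ::
    "(real ^ 'n) \<times> (real ^ 'n ^ 'n) \<Rightarrow> real ^ 'n \<Rightarrow> (real ^ 'n) \<times> (real ^ 'n ^ 'n)" where
  "ellipsoid_step E g =
     (let w = fst E; A = snd E; d = real CARD('n);
          b = (1 / sqrt (g \<bullet> (A *v g))) *\<^sub>R (A *v g);
          bb = (\<chi> i j. b $ i * b $ j)
      in (w - (1 / (d + 1)) *\<^sub>R b,
          (d\<^sup>2 / (d\<^sup>2 - 1)) *\<^sub>R (A - bb) + (d / (d + 1))\<^sup>2 *\<^sub>R bb))"

text \<open>
  The result of the ellipsoid run is the accepted iterate, if there is one, together with the list
  of outputs of the extended oracle gathered so far. Each entry of that list is the outcome of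
  exactly one call of \<open>\<O>\<close>, so its length counts the oracle calls.
\<close>

primrec ellipsoid_run ::
    "real \<Rightarrow> real \<Rightarrow> (real ^ 'n \<Rightarrow> real ^ 'n) \<Rightarrow> real ^ 'n \<Rightarrow> real \<Rightarrow> nat \<Rightarrow>
     (real ^ 'n) \<times> (real ^ 'n ^ 'n) \<Rightarrow> ((real ^ 'n) \<times> (real ^ 'n)) list \<Rightarrow>
     (real ^ 'n) option \<times> ((real ^ 'n) \<times> (real ^ 'n)) list" where
  "ellipsoid_run \<alpha> R \<O> x \<epsilon> 0 E ps = (None, ps)"
| "ellipsoid_run \<alpha> R \<O> x \<epsilon> (Suc k) E ps =
     (let w = fst E;
          p = extended_oracle \<alpha> R \<O> (- w);
          v = fst p;
          ps' = ps @ [p]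
      in if (x - v) \<bullet> w < \<epsilon> then ellipsoid_run \<alpha> R \<O> x \<epsilon> k (ellipsoid_step E (v - x)) ps'
         else if norm w > 1 then ellipsoid_run \<alpha> R \<O> x \<epsilon> k (ellipsoid_step E w) ps'
         else (Some w, ps'))"

text \<open>\<open>a\<close> is an optimal solution of the quadratic program over the simplex.\<close>

definition optimal_weights :: "(real ^ 'n) list \<Rightarrow> real ^ 'n \<Rightarrow> real list \<Rightarrow> bool" where
  "optimal_weights vs x a \<longleftrightarrow>
     is_arg_min (\<lambda>a. 1 / 2 * (norm ((\<Sum>i<length vs. a ! i *\<^sub>R vs ! i) - x))\<^sup>2)
       (\<lambda>a. length a = length vs \<and> (\<forall>i<length vs. 0 \<le> a ! i) \<and> (\<Sum>i<length vs. a ! i) = 1) a"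

datatype 'v sod_result =
  Hyperplane 'v
| Decomposition "real list" "('v \<times> 'v) list"

text \<open>
  Separation-or-decomposition, paired with the number of oracle calls. The ellipsoid method starts
  from the unit ball, which contains the feasible set. The function \<open>qp\<close> supplies the optimal
  weights, and \<open>N x \<epsilon>\<close> is the number of iterations.
\<close>

definition sep_or_decomp ::
    "real \<Rightarrow> real \<Rightarrow> (real ^ 'n \<Rightarrow> real ^ 'n) \<Rightarrow> ((real ^ 'n) list \<Rightarrow> real ^ 'n \<Rightarrow> real list) \<Rightarrow>
     (real ^ 'n \<Rightarrow> real \<Rightarrow> nat) \<Rightarrow> real \<Rightarrow> real ^ 'n \<Rightarrow> (real ^ 'n) sod_result \<times> nat" where
  "sep_or_decomp \<alpha> R \<O> qp N \<epsilon> x =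
     (case ellipsoid_run \<alpha> R \<O> x \<epsilon> (N x \<epsilon>) (0, mat 1) [] of
        (Some w, ps) \<Rightarrow> (Hyperplane w, length ps)
      | (None, ps) \<Rightarrow> (Decomposition (qp (map fst ps) x) ps, length ps))"

text \<open>
  The iteration count is a positive integer of order \<open>d\<^sup>2 ln (((\<alpha> + 1) R + norm x) / \<epsilon>)\<close>: at least
  \<open>c\<close> times and at most \<open>c'\<close> times this quantity. In the upper bound the logarithm is truncated from
  below at 1, because it can be arbitrarily small or negative whereas the count is at least 1.
\<close>

definition iteration_count ::
    "real \<Rightarrow> real \<Rightarrow> real \<Rightarrow> real \<Rightarrow> (real ^ 'n \<Rightarrow> real \<Rightarrow> nat) \<Rightarrow> bool" where
  "iteration_count c c' \<alpha> R N \<longleftrightarrow>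
     (\<forall>x. \<forall>\<epsilon>>0.
        0 < N x \<epsilon> \<and>
        c * (real CARD('n))\<^sup>2 * ln (((\<alpha> + 1) * R + norm x) / \<epsilon>) \<le> real (N x \<epsilon>) \<and>
        real (N x \<epsilon>) \<le> c' * (real CARD('n))\<^sup>2 * max 1 (ln (((\<alpha> + 1) * R + norm x) / \<epsilon>)))"

text \<open>
  The loop of the projection algorithm. The natural number accumulates oracle calls, and
  \<^const>\<open>None\<close> is the value of a loop that does not terminate.
\<close>

partial_function (option) projection_loop ::
    "real \<Rightarrow> real \<Rightarrow> (real ^ 'n \<Rightarrow> real ^ 'n) \<Rightarrow> ((real ^ 'n) list \<Rightarrow> real ^ 'n \<Rightarrow> real list) \<Rightarrow>
     (real ^ 'n \<Rightarrow> real \<Rightarrow> nat) \<Rightarrow> real \<Rightarrow> real ^ 'n \<Rightarrow> nat \<Rightarrow>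
     ((real ^ 'n) \<times> real list \<times> ((real ^ 'n) \<times> (real ^ 'n)) list \<times> nat) option" where
  "projection_loop \<alpha> R \<O> qp N \<epsilon> y n =
     (case sep_or_decomp \<alpha> R \<O> qp N \<epsilon> y of (r, m) \<Rightarrow>
        (case r of
           Hyperplane w \<Rightarrow> projection_loop \<alpha> R \<O> qp N \<epsilon> (y - \<epsilon> *\<^sub>R w) (n + m)
         | Decomposition a ps \<Rightarrow> Some (y, a, ps, n + m)))"

definition projection ::
    "real \<Rightarrow> real \<Rightarrow> (real ^ 'n \<Rightarrow> real ^ 'n) \<Rightarrow> ((real ^ 'n) list \<Rightarrow> real ^ 'n \<Rightarrow> real list) \<Rightarrow>
     (real ^ 'n \<Rightarrow> real \<Rightarrow> nat) \<Rightarrow> real \<Rightarrow> real ^ 'n \<Rightarrow>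
     ((real ^ 'n) \<times> real list \<times> ((real ^ 'n) \<times> (real ^ 'n)) list \<times> nat) option" where
  "projection \<alpha> R \<O> qp N \<epsilon> y =
     projection_loop \<alpha> R \<O> qp N \<epsilon> (y /\<^sub>R max 1 (norm y / (\<alpha> * R))) 0"

text \<open>
  State of the full-information algorithm after \<open>t\<close> rounds: the current point \<open>y\<close>, the list of all
  actions chosen so far (the \<open>t\<close> actions already played followed by the next one) and the total
  number of oracle calls. The vectors \<open>f\<close> are fixed in advance (oblivious adversary); the only
  randomness is the sampling of the next action. A subprobability mass function is used so
  that a projection loop that does not terminate shows up as missing mass.
\<close>

primrec full_information ::
    "real \<Rightarrow> real \<Rightarrow> (real ^ 'n \<Rightarrow> real ^ 'n) \<Rightarrow> ((real ^ 'n) list \<Rightarrow> real ^ 'n \<Rightarrow> real list) \<Rightarrow>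
     (real ^ 'n \<Rightarrow> real \<Rightarrow> nat) \<Rightarrow> real ^ 'n \<Rightarrow> (nat \<Rightarrow> real ^ 'n) \<Rightarrow> real \<Rightarrow> real \<Rightarrow> nat \<Rightarrow>
     ((real ^ 'n) \<times> (real ^ 'n) list \<times> nat) spmf" where
  "full_information \<alpha> R \<O> qp N s1 f \<eta> \<epsilon> 0 = return_spmf (\<alpha> *\<^sub>R s1, [s1], 0)"
| "full_information \<alpha> R \<O> qp N s1 f \<eta> \<epsilon> (Suc t) =
     bind_spmf (full_information \<alpha> R \<O> qp N s1 f \<eta> \<epsilon> t) (\<lambda>(y, ss, n).
     bind_spmf (return_pmf (projection \<alpha> R \<O> qp N \<epsilon>
         (if \<alpha> \<ge> 1 then y - \<eta> *\<^sub>R f t else y + \<eta> *\<^sub>R f t))) (\<lambda>(y', a, ps, m).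
     map_spmf (\<lambda>s. (y', ss @ [s], n + m))
       (spmf_of_pmf (pmf_of_list (zip (map snd ps) a)))))"

definition plays :: "(real ^ 'n) \<times> (real ^ 'n) list \<times> nat \<Rightarrow> nat \<Rightarrow> real ^ 'n" where
  "plays \<sigma> t = fst (snd \<sigma>) ! t"

definition oracle_calls :: "(real ^ 'n) \<times> (real ^ 'n) list \<times> nat \<Rightarrow> nat" where
  "oracle_calls \<sigma> = snd (snd \<sigma>)"

definition expected_regret ::
    "real \<Rightarrow> (real ^ 'n) set \<Rightarrow> nat \<Rightarrow> (nat \<Rightarrow> real ^ 'n) \<Rightarrow>
     ((real ^ 'n) \<times> (real ^ 'n) list \<times> nat) spmf \<Rightarrow> real" where
  "expected_regret \<alpha> \<K> T f run = (\<integral>\<sigma>. alpha_regret \<alpha> \<K> T (plays \<sigma>) f \<partial>measure_spmf run)"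

text \<open>The average number of oracle calls per round is at most \<open>B\<close> in every possible run.\<close>

definition average_calls_le ::
    "nat \<Rightarrow> ((real ^ 'n) \<times> (real ^ 'n) list \<times> nat) spmf \<Rightarrow> real \<Rightarrow> bool" where
  "average_calls_le T run B \<longleftrightarrow> (\<forall>\<sigma> \<in> set_spmf run. real (oracle_calls \<sigma>) / real T \<le> B)"

end

(*
  A separating vector w moves the iterate y closer to every point of alpha K at once, lowering the
  squared distance by eps^2; this bounds the number of such steps. If no separating vector is
  found, the ellipsoid method has excluded every ball of radius r = 2 eps / (3 eps + 2 Q), where
  Q = (alpha + 1) R + norm x, so the oracle outputs v_i have a convex combination within 3 eps
  of x: otherwise the normalised direction from the nearest combination to x, shrunk slightly, would
  be the centre of such a ball of vectors separating x from all v_i. Since each s_i dominates v_i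
  on the orthant, playing s_i with the weights of the combination costs at most 3 F eps more than y,
  and the rest is the standard analysis of online gradient descent for y. With an oblivious adversary
  y is deterministic.

  The volume argument is replaced by determinants: an ellipsoid w + P B containing a ball of radius
  r satisfies |det P| >= r^d, because a contraction has determinant at most 1 in absolute value.
*)

theory Submission
  imports Defs
begin

subsection \<open>Determinants\<close>

text \<open>The call bound is amortised over the rounds. The distance bound
  \<open>2 * (\<alpha> * R)\<close> alone would allow about
  \<open>4 * \<alpha>\<^sup>2 * R\<^sup>2 / \<epsilon>\<^sup>2\<close> hyperplane steps in every
  round. Instead the squared distance from \<open>y\<close> to the single point
  \<open>\<alpha> *\<^sub>R s1\<close> serves as a potential: it starts at 0, a gradient step raises
  it by at most \<open>4 * \<eta> * \<alpha> * R * F + \<eta>\<^sup>2 * F\<^sup>2\<close>, and each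
  hyperplane step lowers it by \<open>\<epsilon>\<^sup>2\<close>. The ball used against the
  ellipsoid method depends on all oracle outputs, so it is known only when the run is over. It still
  survives every cut, since each cut comes from one of these outputs or from the norm constraint. A
  ball instead of a point is what costs the slack between \<epsilon> and 3 \<epsilon>: the margin
  must withstand a perturbation by r against vectors of length up to 2 Q. The algorithm stores only
  the matrix of the ellipsoid, while the determinant argument needs a factor P. No positive
  definiteness is carried along: as long as the ellipsoid contains a ball, P is invertible and the
  division by \<open>sqrt (g \<bullet> (A *v g))\<close> is meaningful.\<close>

definition outer :: "real ^ 'n \<Rightarrow> real ^ 'n \<Rightarrow> real ^ 'n ^ 'n" where
  "outer u v = (\<chi> i j. u $ i * v $ j)"

lemma outer_vector_mult: "outer u v *v x = (v \<bullet> x) *\<^sub>R u"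
  by (simp add: outer_def vec_eq_iff matrix_vector_mult_def inner_vec_def sum_distrib_left
      sum_distrib_right mult_ac)

text \<open>For a unit vector u, the factor is q along u and p on the orthogonal complement. This is
  one ellipsoid update in coordinates where the current ellipsoid is the unit ball.\<close>

definition axial_stretch :: "real \<Rightarrow> real \<Rightarrow> real ^ 'n \<Rightarrow> real ^ 'n ^ 'n" where
  "axial_stretch p q u = p *\<^sub>R (mat 1 - outer u u) + q *\<^sub>R outer u u"

lemma axial_stretch_vector_mult:
  "axial_stretch p q u *v x = p *\<^sub>R (x - (u \<bullet> x) *\<^sub>R u) + (q * (u \<bullet> x)) *\<^sub>R u"
  by (simp add: axial_stretch_def matrix_vector_mult_add_rdistrib matrix_vector_mult_diff_rdistrib
      outer_vector_mult flip: scaleR_matrix_vector_assoc)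

text \<open>This lifts the matrix update of \<open>ellipsoid_step\<close> to factors: if
  \<open>A = P ** transpose P\<close> and \<open>b = P *v u\<close>, the right-hand side has exactly
  the shape in which the new matrix is defined there.\<close>

lemma matrix_mult_axial_stretch_squared:
  fixes P :: "real ^ 'n ^ 'n"
  assumes "norm u = 1"
  shows "(P ** axial_stretch p q u) ** transpose (P ** axial_stretch p q u) =
         p\<^sup>2 *\<^sub>R (P ** transpose P - outer (P *v u) (P *v u)) + q\<^sup>2 *\<^sub>R outer (P *v u) (P *v u)"
proof -
  have uu: "u \<bullet> u = 1" using assms by (simp add: norm_eq_1)
  have sq: "axial_stretch p q u ** axial_stretch p q u = axial_stretch (p\<^sup>2) (q\<^sup>2) u"
    by (simp add: matrix_eq axial_stretch_vector_mult uu inner_simps algebra_simps power2_eq_square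
        flip: matrix_vector_mul_assoc)
  have sym: "transpose (axial_stretch p q u) = axial_stretch p q u"
    by (simp add: axial_stretch_def transpose_def outer_def vec_eq_iff mat_def mult_ac)
  have "(P ** axial_stretch p q u) ** transpose (P ** axial_stretch p q u) =
        P ** axial_stretch (p\<^sup>2) (q\<^sup>2) u ** transpose P"
    by (metis matrix_mul_assoc matrix_transpose_mul sq sym)
  also have "\<dots> = p\<^sup>2 *\<^sub>R (P ** transpose P - outer (P *v u) (P *v u)) + q\<^sup>2 *\<^sub>R outer (P *v u) (P *v u)"
  proof -
    have "P ** axial_stretch (p\<^sup>2) (q\<^sup>2) u = p\<^sup>2 *\<^sub>R (P - outer (P *v u) u) + q\<^sup>2 *\<^sub>R outer (P *v u) u"
      by (simp add: matrix_eq axial_stretch_vector_mult outer_vector_mult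
          matrix_vector_mult_add_rdistrib matrix_vector_mult_diff_rdistrib
          matrix_vector_mult_scaleR matrix_vector_right_distrib
          matrix_vector_mult_diff_distrib mult_ac
          flip: matrix_vector_mul_assoc scaleR_matrix_vector_assoc)
    moreover have "outer (P *v u) u *v (transpose P *v x) = outer (P *v u) (P *v u) *v x" for x
      by (simp add: outer_vector_mult) (metis dot_lmul_matrix inner_commute)
    ultimately show ?thesis
      by (simp add: matrix_eq matrix_vector_mult_add_rdistrib matrix_vector_mult_diff_rdistrib
          del: transpose_matrix_vector
          flip: matrix_vector_mul_assoc scaleR_matrix_vector_assoc)
  qed
  finally show ?thesis .
qed

text \<open>An orthogonal matrix taking a basis vector to u conjugates the stretch to a diagonal
  matrix.\<close>

lemma det_axial_stretch:
  fixes u :: "real ^ 'n"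
  assumes "norm u = 1"
  shows "det (axial_stretch p q u) = q * p ^ (CARD('n) - 1)"
proof -
  fix k :: 'n
  obtain Q where Q: "orthogonal_matrix Q" and Qk: "Q *v axis k 1 = u"
    using orthogonal_matrix_exists_basis[OF assms] by blast
  have QQ: "transpose Q ** Q = mat 1" and QQ': "Q ** transpose Q = mat 1"
    using Q by (auto simp: orthogonal_matrix_def)
  define D where "D = axial_stretch p q (axis k 1 :: real ^ 'n)"
  have "axial_stretch p q u ** Q = Q ** D"
  proof -
    have "u \<bullet> (Q *v x) = axis k 1 \<bullet> x" for x
      using dot_lmul_matrix[of "axis k 1" "transpose Q" "Q *v x"] QQ Qk
      by (simp add: matrix_vector_mul_assoc del: transpose_matrix_vector)
    then show ?thesis
      by (simp add: D_def matrix_eq axial_stretch_vector_mult Qk matrix_vector_mult_scaleR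
          matrix_vector_right_distrib matrix_vector_mult_diff_distrib
          flip: matrix_vector_mul_assoc)
  qed
  then have "det (axial_stretch p q u) * det Q = det Q * det D"
    by (metis det_mul)
  then have "det (axial_stretch p q u) = det D"
    using det_orthogonal_matrix[OF Q] by auto
  also have "\<dots> = (\<Prod>i\<in>UNIV. D $ i $ i)"
    by (rule det_diagonal) (auto simp: D_def axial_stretch_def outer_def axis_def mat_def)
  also have "\<dots> = (\<Prod>i\<in>UNIV. if i = k then q else p)"
    by (rule prod.cong) (auto simp: D_def axial_stretch_def outer_def axis_def mat_def)
  also have "\<dots> = q * p ^ (CARD('n) - 1)"
  proof -
    have "(\<Prod>i\<in>UNIV - {k}. if i = k then q else p) = (\<Prod>i\<in>UNIV - {k}. p)"
      by (rule prod.cong) auto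
    then show ?thesis
      by (subst prod.remove[of _ k]) (auto simp: card_Diff_singleton)
  qed
  finally show ?thesis .
qed

section \<open>Determinants of contractions and of ellipsoids containing a ball\<close>

primrec matrix_power :: "real ^ 'n ^ 'n \<Rightarrow> nat \<Rightarrow> real ^ 'n ^ 'n" where
  "matrix_power A 0 = mat 1"
| "matrix_power A (Suc k) = A ** matrix_power A k"

text \<open>
  The powers of a contraction have entries in \<open>[-1, 1]\<close>, hence determinants bounded by \<open>d!\<close>; this
  is impossible if the determinant exceeds 1 in absolute value.
\<close>

lemma abs_det_contraction_le_1:
  fixes B :: "real ^ 'n ^ 'n"
  assumes B: "\<And>x. norm (B *v x) \<le> norm x"
  shows "\<bar>det B\<bar> \<le> 1"
proof (rule ccontr)
  assume "\<not> \<bar>det B\<bar> \<le> 1"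
  then have gt: "1 < \<bar>det B\<bar>" by simp
  have contr: "norm (matrix_power B k *v x) \<le> norm x" for k x
  proof (induction k)
    case (Suc k)
    then show ?case
      using B[of "matrix_power B k *v x"] by (simp add: matrix_vector_mul_assoc)
  qed auto
  have entry: "\<bar>matrix_power B k $ i $ j\<bar> \<le> 1" for k i j
  proof -
    have "\<bar>(matrix_power B k *v axis j 1) $ i\<bar> \<le> norm (axis j 1 :: real ^ 'n)"
      using component_le_norm_cart[of "matrix_power B k *v axis j 1" i] contr order_trans by blast
    then show ?thesis
      by (simp add: matrix_vector_mul_component inner_axis norm_axis_1)
  qed
  have bound: "\<bar>det (matrix_power B k)\<bar> \<le> real (card {p. p permutes (UNIV :: 'n set)})" for k
  proof -
    have "\<bar>det (matrix_power B k)\<bar> \<le> (\<Sum>p | p permutes (UNIV :: 'n set).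
        \<bar>of_int (sign p) * (\<Prod>i\<in>UNIV. matrix_power B k $ i $ p i)\<bar>)"
      unfolding det_def by (rule sum_abs)
    also have "\<dots> \<le> (\<Sum>p | p permutes (UNIV :: 'n set). 1)"
    proof (rule sum_mono)
      fix p
      have "\<bar>\<Prod>i\<in>UNIV. matrix_power B k $ i $ p i\<bar> \<le> 1"
        unfolding abs_prod by (rule prod_le_1) (auto simp: entry)
      then show "\<bar>of_int (sign p) * (\<Prod>i\<in>UNIV. matrix_power B k $ i $ p i)\<bar> \<le> 1"
        by (simp add: abs_mult sign_def)
    qed
    finally show ?thesis by simp
  qed
  have "det (matrix_power B k) = det B ^ k" for k
    by (induction k) (auto simp: det_mul)
  then have "\<bar>det B\<bar> ^ k \<le> real (card {p. p permutes (UNIV :: 'n set)})" for k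
    using bound[of k] by (simp add: power_abs)
  moreover obtain k where "real (card {p. p permutes (UNIV :: 'n set)}) < \<bar>det B\<bar> ^ k"
    using real_arch_pow[OF gt] by blast
  ultimately show False
    by (meson not_less)
qed

text \<open>For a unit vector u the ellipsoid has width \<open>2 * norm (transpose P *v u)\<close>
  in direction u, which is at least the width 2 r of the ball. So \<open>transpose P\<close> is
  injective and r times its inverse is a contraction.\<close>

lemma cball_in_ellipsoid_abs_det_ge:
  fixes P :: "real ^ 'n ^ 'n"
  assumes "0 < r" and sub: "cball c r \<subseteq> (\<lambda>y. w + P *v y) ` cball 0 1"
  shows "r ^ CARD('n) \<le> \<bar>det P\<bar>"
proof -
  have expand: "r * norm u \<le> norm (transpose P *v u)" for u
    proof (cases "u = 0")
      case False
      define e where "e = (r / norm u) *\<^sub>R u"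
      have "norm e = r" using False \<open>0 < r\<close> by (simp add: e_def)
      then have "c + e \<in> cball c r" "c - e \<in> cball c r" by (auto simp: dist_norm)
      then obtain y z where y: "c + e = w + P *v y" "norm y \<le> 1"
        and z: "c - e = w + P *v z" "norm z \<le> 1"
        using sub by (smt (verit, best) image_iff mem_cball_0 subsetD)
      have Pu: "\<bar>u \<bullet> (P *v x)\<bar> \<le> norm (transpose P *v u)" if "norm x \<le> 1" for x
      proof -
        have "\<bar>(transpose P *v u) \<bullet> x\<bar> \<le> norm (transpose P *v u) * norm x"
          by (rule Cauchy_Schwarz_ineq2)
        also have "\<dots> \<le> norm (transpose P *v u)"
          using that by (simp add: mult_left_le)
        finally show ?thesis
          by (simp add: dot_lmul_matrix)
      qed
      have "2 *\<^sub>R e = (c + e) - (c - e)"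
        by (simp add: scaleR_2)
      also have "\<dots> = P *v y - P *v z"
        unfolding y(1) z(1) by simp
      finally have "2 * (u \<bullet> e) = u \<bullet> (P *v y) - u \<bullet> (P *v z)"
        by (metis inner_diff_right inner_scaleR_right)
      also have "\<dots> \<le> 2 * norm (transpose P *v u)"
        using Pu[OF y(2)] Pu[OF z(2)] by simp
      finally show ?thesis
        using False by (simp add: e_def power2_norm_eq_inner[symmetric] power2_eq_square)
    qed auto
  have inv: "invertible (transpose P)"
    unfolding invertible_left_inverse matrix_left_invertible_ker
  proof (intro allI impI)
    fix u assume "transpose P *v u = 0"
    then have "r * norm u \<le> 0" using expand[of u] by simp
    then show "u = 0" using \<open>0 < r\<close> by (simp add: mult_le_0_iff)
  qed
  then obtain B where B: "transpose P ** B = mat 1"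
    by (auto simp: invertible_def)
  have "norm ((r *\<^sub>R B) *v x) \<le> norm x" for x
    using expand[of "B *v x"] B \<open>0 < r\<close>
    by (simp add: matrix_vector_mul_assoc flip: scaleR_matrix_vector_assoc del: transpose_matrix_vector)
  then have "\<bar>det (r *\<^sub>R B)\<bar> \<le> 1" by (rule abs_det_contraction_le_1)
  moreover have "det (r *\<^sub>R B) = r ^ CARD('n) * det B"
  proof -
    have "r *\<^sub>R B = mat r ** B"
      by (simp add: vec_eq_iff matrix_matrix_mult_def mat_def if_distrib if_distribR cong: if_cong)
    then show ?thesis by (simp add: det_mul det_diagonal mat_def)
  qed
  moreover have "det P * det B = 1"
    using B by (metis det_I det_mul det_transpose)
  ultimately show ?thesis
    by (metis \<open>0 < r\<close> abs_mult abs_of_pos abs_one mult.commute mult.left_neutral mult_left_mono abs_ge_zero zero_less_power mult.assoc)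
qed

subsection \<open>The ellipsoid method\<close>

lemma scaleR_inner_unit_dim_1:
  fixes u y :: "real ^ 'n"
  assumes "CARD('n) = 1" "norm u = 1"
  shows "(u \<bullet> y) *\<^sub>R u = y"
proof -
  obtain i :: 'n where i: "UNIV = {i}"
    using assms(1) card_1_singletonE by metis
  have "u $ i * u $ i = 1"
    using assms(2) by (simp add: norm_eq_1 inner_vec_def i)
  then have *: "u $ i * (u $ i * y $ i) = y $ i"
    by (metis mult.assoc mult_1)
  have "((u \<bullet> y) *\<^sub>R u) $ j = y $ j" for j
  proof -
    have "j = i" using i by auto
    then show ?thesis using * by (simp add: inner_vec_def i mult_ac)
  qed
  then show ?thesis by (simp add: vec_eq_iff)
qed

text \<open>
  In dimension 1 the factor \<open>p\<close> is the junk value \<open>sqrt (1 / 0) = 0\<close>, which is harmless because the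
  orthogonal complement of \<open>u\<close> is trivial.
\<close>

lemma half_ball_in_stretched_ball:
  fixes u y :: "real ^ 'n"
  assumes u: "norm u = 1" and y: "norm y \<le> 1" "u \<bullet> y \<le> 0"
  defines "d \<equiv> real CARD('n)"
  defines "p \<equiv> sqrt (d\<^sup>2 / (d\<^sup>2 - 1))" and "q \<equiv> d / (d + 1)"
  shows "y + (1 / (d + 1)) *\<^sub>R u \<in> (*v) (axial_stretch p q u) ` cball 0 1"
proof -
  define t where "t = u \<bullet> y"
  define x where "x = (1 / p) *\<^sub>R (y - t *\<^sub>R u) + ((t + 1 / (d + 1)) / q) *\<^sub>R u"
  have d: "1 \<le> d" by (simp add: d_def)
  have uu: "u \<bullet> u = 1" using u by (simp add: norm_eq_1)
  have yu: "y \<bullet> u = t" by (simp add: t_def inner_commute)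
  have q0: "q \<noteq> 0" using d by (simp add: q_def)
  have ux: "u \<bullet> x = (t + 1 / (d + 1)) / q"
    by (simp add: x_def inner_simps uu t_def)
  have "p * (1 / p) = 1 \<or> y - t *\<^sub>R u = 0"
  proof (cases "CARD('n) = 1")
    case True
    then show ?thesis using scaleR_inner_unit_dim_1[OF True u] by (simp add: t_def)
  next
    case False
    moreover have "CARD('n) \<noteq> 0" by simp
    ultimately have "1 < CARD('n)" by linarith
    then have "1 < d" by (simp add: d_def)
    then have "1 < d\<^sup>2" by simp
    then have "p \<noteq> 0" using d by (simp add: p_def)
    then show ?thesis by simp
  qed
  then have "axial_stretch p q u *v x = y + (1 / (d + 1)) *\<^sub>R u"
  proof -
    assume "p * (1 / p) = 1 \<or> y - t *\<^sub>R u = 0"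
    then have "p *\<^sub>R ((1 / p) *\<^sub>R (y - t *\<^sub>R u)) = y - t *\<^sub>R u" by auto
    moreover have "x - (u \<bullet> x) *\<^sub>R u = (1 / p) *\<^sub>R (y - t *\<^sub>R u)"
      unfolding ux by (simp add: x_def)
    ultimately show ?thesis
      unfolding axial_stretch_vector_mult by (simp add: ux q0 scaleR_add_left)
  qed
  moreover have "norm x \<le> 1"
  proof -
    have t: "- 1 \<le> t" "t \<le> 0"
      using Cauchy_Schwarz_ineq2[of u y] y u by (auto simp: t_def)
    have p2: "(1 / p)\<^sup>2 = (d\<^sup>2 - 1) / d\<^sup>2"
      using d by (simp add: p_def power_divide)
    have "(norm x)\<^sup>2 = (1 / p)\<^sup>2 * ((norm y)\<^sup>2 - t\<^sup>2) + ((t + 1 / (d + 1)) / q)\<^sup>2"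
      unfolding x_def power2_norm_eq_inner
      by (simp add: inner_simps uu yu t_def[symmetric] power2_eq_square algebra_simps)
    also have "\<dots> \<le> (1 / p)\<^sup>2 * (1 - t\<^sup>2) + ((t + 1 / (d + 1)) / q)\<^sup>2"
      using y by (intro add_right_mono mult_left_mono) (auto simp: power_le_one)
    \<comment> \<open>The excess over 1 vanishes exactly at t = -1 and t = 0: the new ellipsoid
      touches the half ball at its pole and along its equator.\<close>
    also have "\<dots> = 1 + 2 * (d + 1) * (t * (t + 1)) / d\<^sup>2"
      unfolding p2 q_def using d by (simp add: divide_simps) (simp add: power2_eq_square algebra_simps)
    also have "\<dots> \<le> 1"
    proof -
      have "t * (t + 1) \<le> 0" using t by (simp add: mult_nonpos_nonneg)
      with d have "2 * (d + 1) * (t * (t + 1)) \<le> 0" by (simp add: mult_nonneg_nonpos del: mult_le_0_iff)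
      then have "2 * (d + 1) * (t * (t + 1)) / d\<^sup>2 \<le> 0" by (rule divide_nonpos_nonneg) simp
      then show ?thesis by linarith
    qed
    finally show ?thesis by (simp add: power_le_one_iff)
  qed
  ultimately show ?thesis
    by (metis image_eqI mem_cball_0)
qed

text \<open>The usual volume ratio guaranteed by a central cut. The dimension is passed as a type
  argument because it is not determined by any value.\<close>

definition ellipsoid_shrink :: "'n itself \<Rightarrow> real" where
  "ellipsoid_shrink _ = exp (- 1 / (2 * (real CARD('n) + 1)))"

text \<open>The left side is the determinant of one update. By \<open>1 + x \<le> exp x\<close>, the
  factor along the cut is at most \<open>exp (- 1 / (d + 1))\<close>, and the other d - 1 factors
  together are at most \<open>exp (1 / (2 * (d + 1)))\<close>, because
  \<open>(d - 1) / (d\<^sup>2 - 1) = 1 / (d + 1)\<close>. This cancellation fails for d = 1, where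
  the power is empty.\<close>

lemma stretch_factor_le:
  fixes d :: nat
  assumes "1 \<le> d"
  shows "real d / (real d + 1) * sqrt ((real d)\<^sup>2 / ((real d)\<^sup>2 - 1)) ^ (d - 1)
    \<le> exp (- 1 / (2 * (real d + 1)))"
proof (cases "d = 1")
  case True
  have "1 / 2 \<le> 1 - 1 / (4::real)" by simp
  also have "\<dots> \<le> exp (- 1 / 4)" using exp_ge_add_one_self[of "- 1 / 4 :: real"] by simp
  finally show ?thesis using True by simp
next
  case False
  define D where "D = real d"
  have D: "2 \<le> D" using False assms by (simp add: D_def)
  then have D2: "1 < D\<^sup>2" by simp
  have "D\<^sup>2 / (D\<^sup>2 - 1) = 1 + 1 / (D\<^sup>2 - 1)" using D2 by (simp add: field_simps)
  also have "\<dots> \<le> exp (1 / (D\<^sup>2 - 1))" by (rule exp_ge_add_one_self)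
  also have "\<dots> = (exp (1 / (2 * (D\<^sup>2 - 1))))\<^sup>2" using D2 by (simp add: exp_double[symmetric] field_simps)
  finally have "sqrt (D\<^sup>2 / (D\<^sup>2 - 1)) \<le> exp (1 / (2 * (D\<^sup>2 - 1)))"
    by (simp add: real_le_lsqrt)
  then have "sqrt (D\<^sup>2 / (D\<^sup>2 - 1)) ^ (d - 1) \<le> exp (1 / (2 * (D\<^sup>2 - 1))) ^ (d - 1)"
    using D2 by (intro power_mono) auto
  also have "\<dots> = exp (1 / (2 * (D + 1)))"
  proof -
    have "real (d - 1) = D - 1" using assms by (simp add: D_def)
    then have "real (d - 1) * (1 / (2 * (D\<^sup>2 - 1))) = (D - 1) / (2 * ((D - 1) * (D + 1)))"
      by (simp add: power2_eq_square algebra_simps)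
    also have "\<dots> = 1 / (2 * (D + 1))" using D by simp
    finally show ?thesis by (simp add: exp_of_nat_mult[symmetric])
  qed
  finally have A: "sqrt (D\<^sup>2 / (D\<^sup>2 - 1)) ^ (d - 1) \<le> exp (1 / (2 * (D + 1)))" .
  have "D / (D + 1) = 1 + (- 1 / (D + 1))" using D by (simp add: field_simps)
  also have "\<dots> \<le> exp (- 1 / (D + 1))" by (rule exp_ge_add_one_self)
  finally have "D / (D + 1) * sqrt (D\<^sup>2 / (D\<^sup>2 - 1)) ^ (d - 1)
      \<le> exp (- 1 / (D + 1)) * exp (1 / (2 * (D + 1)))"
    using A D D2 by (intro mult_mono) auto
  also have "\<dots> = exp (- 1 / (2 * (D + 1)))"
    using D by (simp add: exp_add[symmetric]) (simp add: field_simps)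
  finally show ?thesis by (simp add: D_def)
qed

text \<open>The factor P of the stored matrix is unique only up to an orthogonal factor on the
  right, which changes neither the ellipsoid nor the absolute determinant; hence the
  existential.\<close>

definition in_ellipsoid ::
    "(real ^ 'n) set \<Rightarrow> (real ^ 'n) \<times> (real ^ 'n ^ 'n) \<Rightarrow> real \<Rightarrow> bool" where
  "in_ellipsoid S E \<delta> \<longleftrightarrow> (\<exists>P. snd E = P ** transpose P \<and>
     S \<subseteq> (\<lambda>y. fst E + P *v y) ` cball 0 1 \<and> \<bar>det P\<bar> \<le> \<delta>)"

text \<open>In the coordinates given by P the ellipsoid is the unit ball and the cut is a half-space
  through the centre with normal \<open>transpose P *v g\<close>. The ball inside S makes P
  invertible, so this normal is nonzero and can be normalised.\<close>

lemma in_ellipsoid_step: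
  fixes S :: "(real ^ 'n) set"
  assumes S: "cball c r \<subseteq> S" "0 < r"
    and E: "in_ellipsoid S E \<delta>"
    and g: "g \<noteq> 0" "\<And>z. z \<in> S \<Longrightarrow> g \<bullet> z \<le> g \<bullet> fst E"
  shows "in_ellipsoid S (ellipsoid_step E g) (\<delta> * ellipsoid_shrink TYPE('n))"
proof -
  obtain P where P: "snd E = P ** transpose P" "S \<subseteq> (\<lambda>y. fst E + P *v y) ` cball 0 1"
    "\<bar>det P\<bar> \<le> \<delta>"
    using E by (auto simp: in_ellipsoid_def)
  define d where "d = real CARD('n)"
  define p where "p = sqrt (d\<^sup>2 / (d\<^sup>2 - 1))"
  define q where "q = d / (d + 1)"
  define h where "h = transpose P *v g"
  define u where "u = (1 / norm h) *\<^sub>R h"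
  have d: "1 \<le> d" by (simp add: d_def)
  have "0 < \<bar>det P\<bar>"
    using cball_in_ellipsoid_abs_det_ge[OF S(2), of c "fst E" P] S P(2)
      zero_less_power[OF S(2), of "CARD('n)"] by (meson less_le_trans subset_trans)
  then have "invertible (transpose P)"
    by (simp add: invertible_det_nz)
  then have h0: "h \<noteq> 0"
    using g(1) unfolding h_def invertible_left_inverse matrix_left_invertible_ker by blast
  then have u: "norm u = 1" by (simp add: u_def)
  have Ag: "snd E *v g = norm h *\<^sub>R (P *v u)"
    using h0 by (simp add: P(1) u_def h_def matrix_vector_mult_scaleR matrix_vector_mul_assoc
        del: transpose_matrix_vector)
  have gPx: "g \<bullet> (P *v x) = norm h * (u \<bullet> x)" for x
    using h0 by (simp add: u_def h_def dot_lmul_matrix)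
  have "g \<bullet> (snd E *v g) = (norm h)\<^sup>2"
    using u by (simp add: Ag gPx norm_eq_1 power2_eq_square)
  then have b: "(1 / sqrt (g \<bullet> (snd E *v g))) *\<^sub>R (snd E *v g) = P *v u"
    using h0 by (simp add: Ag)
  define P' where "P' = P ** axial_stretch p q u"
  have "p\<^sup>2 = d\<^sup>2 / (d\<^sup>2 - 1)"
    unfolding p_def using d by (intro real_sqrt_pow2) (auto intro!: divide_nonneg_nonneg)
  then have step: "ellipsoid_step E g = (fst E - (1 / (d + 1)) *\<^sub>R (P *v u), P' ** transpose P')"
    unfolding ellipsoid_step_def Let_def b P'_def matrix_mult_axial_stretch_squared[OF u]
    by (simp add: d_def q_def P(1) outer_def)
  have "S \<subseteq> (\<lambda>y. fst (ellipsoid_step E g) + P' *v y) ` cball 0 1"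
  proof
    fix z assume z: "z \<in> S"
    then obtain y where y: "z = fst E + P *v y" "norm y \<le> 1"
      using P(2) by auto
    have "g \<bullet> (P *v y) \<le> 0"
      using g(2)[OF z] by (simp add: y(1) inner_simps)
    then have "u \<bullet> y \<le> 0"
      using h0 by (simp add: gPx mult_le_0_iff)
    from half_ball_in_stretched_ball[OF u y(2) this]
    obtain x where x: "norm x \<le> 1" "y + (1 / (d + 1)) *\<^sub>R u = axial_stretch p q u *v x"
      by (auto simp: d_def p_def q_def)
    have "P' *v x = P *v (y + (1 / (d + 1)) *\<^sub>R u)"
      by (simp add: P'_def x(2) matrix_vector_mul_assoc)
    then have "z = fst (ellipsoid_step E g) + P' *v x"
      by (simp add: step y(1) matrix_vector_right_distrib matrix_vector_mult_scaleR)
    then show "z \<in> (\<lambda>y. fst (ellipsoid_step E g) + P' *v y) ` cball 0 1"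
      using x(1) by auto
  qed
  moreover have "\<bar>det P'\<bar> \<le> \<delta> * ellipsoid_shrink TYPE('n)"
  proof -
    have "0 \<le> d\<^sup>2 - 1" using d by simp
    then have "\<bar>det (axial_stretch p q u)\<bar> = q * p ^ (CARD('n) - 1)"
      using d by (simp add: det_axial_stretch[OF u] p_def q_def)
    also have "\<dots> \<le> ellipsoid_shrink TYPE('n)"
      using stretch_factor_le[of "CARD('n)"] by (simp add: ellipsoid_shrink_def p_def q_def d_def)
    finally show ?thesis
      unfolding P'_def det_mul abs_mult using P(3) by (intro mult_mono) auto
  qed
  ultimately show ?thesis
    unfolding in_ellipsoid_def using step by auto
qed

section \<open>Runs of the ellipsoid method: outputs, calls and surviving sets\<close>

lemma ellipsoid_run_length:
  "length (snd (ellipsoid_run \<alpha> R \<O> x \<epsilon> k E ps)) \<le> length ps + k"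
proof (induction k arbitrary: E ps)
  case (Suc k)
  have "length (snd (ellipsoid_run \<alpha> R \<O> x \<epsilon> k E' (ps @ [p]))) \<le> length ps + Suc k" for E' p
    using Suc[of E' "ps @ [p]"] by simp
  then show ?case by (simp add: Let_def)
qed simp

lemma ellipsoid_run_length_None:
  "fst (ellipsoid_run \<alpha> R \<O> x \<epsilon> k E ps) = None \<Longrightarrow>
   length (snd (ellipsoid_run \<alpha> R \<O> x \<epsilon> k E ps)) = length ps + k"
  by (induction k arbitrary: E ps) (auto simp: Let_def split: if_splits)

lemma ellipsoid_run_range:
  "set (snd (ellipsoid_run \<alpha> R \<O> x \<epsilon> k E ps)) \<subseteq> set ps \<union> range (extended_oracle \<alpha> R \<O>)"
proof (induction k arbitrary: E ps)
  case (Suc k)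
  then show ?case by (auto simp: Let_def dest!: subsetD[OF Suc.IH])
qed simp

lemma ellipsoid_run_mono:
  "set ps \<subseteq> set (snd (ellipsoid_run \<alpha> R \<O> x \<epsilon> k E ps))"
proof (induction k arbitrary: E ps)
  case (Suc k)
  show ?case by (auto simp: Let_def intro: subsetD[OF Suc.IH])
qed simp

lemma ellipsoid_run_Some:
  "fst (ellipsoid_run \<alpha> R \<O> x \<epsilon> k E ps) = Some w \<Longrightarrow>
   norm w \<le> 1 \<and> \<epsilon> \<le> (x - fst (extended_oracle \<alpha> R \<O> (- w))) \<bullet> w"
  by (induction k arbitrary: E ps) (auto simp: Let_def split: if_splits)

text \<open>No cut removes a point of S. A cut by \<open>v - x\<close> is made only if
  \<open>(x - v) \<bullet> w < \<epsilon>\<close>, whereas points z of S have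
  \<open>\<epsilon> \<le> (x - v) \<bullet> z\<close>; a cut by w is made only outside the unit
  ball, which contains S. The margin hypothesis speaks of the outputs of the entire run, because S
  is chosen in hindsight.\<close>

lemma ellipsoid_run_None:
  fixes S :: "(real ^ 'n) set"
  assumes S: "cball c r \<subseteq> S" "0 < r" "S \<subseteq> cball 0 1" and "0 < \<epsilon>"
  shows "fst (ellipsoid_run \<alpha> R \<O> x \<epsilon> k E ps) = None \<Longrightarrow> in_ellipsoid S E \<delta> \<Longrightarrow>
    (\<And>v s z. (v, s) \<in> set (snd (ellipsoid_run \<alpha> R \<O> x \<epsilon> k E ps)) \<Longrightarrow> z \<in> S \<Longrightarrow>
      \<epsilon> \<le> (x - v) \<bullet> z) \<Longrightarrow>
    \<exists>E'. in_ellipsoid S E' (\<delta> * ellipsoid_shrink TYPE('n) ^ k)"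
proof (induction k arbitrary: E ps \<delta>)
  case (Suc k)
  define w where "w = fst E"
  define p where "p = extended_oracle \<alpha> R \<O> (- w)"
  define run where "run = ellipsoid_run \<alpha> R \<O> x \<epsilon> (Suc k) E ps"
  have "c \<in> S" using S by auto
  have p: "p \<in> set (snd run)"
    by (auto simp: run_def Let_def p_def w_def intro: subsetD[OF ellipsoid_run_mono])
  then have sep: "\<epsilon> \<le> (x - fst p) \<bullet> z" if "z \<in> S" for z
    using Suc.prems(3)[of "fst p" "snd p" z] that by (simp add: run_def)
  obtain g where g: "g \<noteq> 0" "\<And>z. z \<in> S \<Longrightarrow> g \<bullet> z \<le> g \<bullet> w"
    and rec: "run = ellipsoid_run \<alpha> R \<O> x \<epsilon> k (ellipsoid_step E g) (ps @ [p])"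
  proof (cases "(x - fst p) \<bullet> w < \<epsilon>")
    case True
    have "fst p - x \<noteq> 0" using sep[OF \<open>c \<in> S\<close>] \<open>0 < \<epsilon>\<close> by auto
    moreover have "(fst p - x) \<bullet> z \<le> (fst p - x) \<bullet> w" if "z \<in> S" for z
      using True sep[OF that] by (simp add: inner_simps)
    ultimately show ?thesis
      using that[of "fst p - x"] True by (simp add: run_def Let_def p_def w_def)
  next
    case False
    then have w: "1 < norm w"
      using Suc.prems(1) by (auto simp: Let_def p_def w_def split: if_splits)
    have "w \<bullet> z \<le> w \<bullet> w" if "z \<in> S" for z
    proof -
      have "norm z \<le> 1" using that S(3) by auto
      have "w \<bullet> z \<le> norm w * norm z" by (rule norm_cauchy_schwarz)
      also have "\<dots> \<le> norm w * norm w"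
        using w \<open>norm z \<le> 1\<close> by (intro mult_left_mono) auto
      finally show ?thesis by (simp add: power2_norm_eq_inner[symmetric] power2_eq_square)
    qed
    moreover have "w \<noteq> 0" using w by auto
    ultimately show ?thesis
      using that[of w] w False by (auto simp: run_def Let_def p_def w_def)
  qed
  have "in_ellipsoid S (ellipsoid_step E g) (\<delta> * ellipsoid_shrink TYPE('n))"
    using in_ellipsoid_step[OF S(1,2) Suc.prems(2) g(1)] g(2) by (simp add: w_def)
  from Suc.IH[OF _ this, of "ps @ [p]"]
  have "\<exists>E'. in_ellipsoid S E' (\<delta> * ellipsoid_shrink TYPE('n) * ellipsoid_shrink TYPE('n) ^ k)"
    using Suc.prems(1,3) rec by (simp add: run_def)
  then show ?case by (simp add: mult_ac)
qed auto

text \<open>The determinant starts at 1 for the unit ball, shrinks geometrically and stays above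
  \<open>r ^ CARD('n)\<close>; logarithms of the two bounds give the claim.\<close>

lemma ellipsoid_run_radius_bound:
  fixes x :: "real ^ 'n"
  assumes "0 < r" "cball c r \<subseteq> cball 0 1" "0 < \<epsilon>"
    and run: "ellipsoid_run \<alpha> R \<O> x \<epsilon> k (0, mat 1) [] = (None, ps)"
    and sep: "\<And>v s z. (v, s) \<in> set ps \<Longrightarrow> z \<in> cball c r \<Longrightarrow> \<epsilon> \<le> (x - v) \<bullet> z"
  shows "real k \<le> 2 * (real CARD('n) + 1) * real CARD('n) * ln (1 / r)"
proof -
  have "in_ellipsoid (cball c r) (0, mat 1) 1"
    unfolding in_ellipsoid_def using assms(2) by (intro exI[of _ "mat 1"]) auto
  then obtain E where "in_ellipsoid (cball c r) E (ellipsoid_shrink TYPE('n) ^ k)"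
    using ellipsoid_run_None[OF order_refl assms(1,2,3), of \<alpha> R \<O> x k "(0, mat 1)" "[]" 1]
      run sep by auto
  then have "r ^ CARD('n) \<le> ellipsoid_shrink TYPE('n) ^ k"
    unfolding in_ellipsoid_def using cball_in_ellipsoid_abs_det_ge[OF assms(1)] order_trans by blast
  then have "ln (r ^ CARD('n)) \<le> ln (ellipsoid_shrink TYPE('n) ^ k)"
    using assms(1) by (subst ln_le_cancel_iff) (auto simp: ellipsoid_shrink_def)
  then have "real CARD('n) * ln r \<le> real k * (- 1 / (2 * (real CARD('n) + 1)))"
    using assms(1) by (simp add: ln_realpow ellipsoid_shrink_def)
  then show ?thesis
    using assms(1) by (simp add: ln_div field_simps)
qed

subsection \<open>The extended oracle\<close>

lemma pos_part_add_neg_part: "pos_part c + neg_part c = c"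
  by (simp add: pos_part_def neg_part_def vec_eq_iff max_def min_def)

lemma pos_part_inner_neg_part: "pos_part c \<bullet> neg_part c = 0"
  unfolding inner_vec_def
  by (rule sum.neutral) (auto simp: pos_part_def neg_part_def max_def min_def)

lemma pos_part_nonneg: "pos_part c \<in> nonneg_orthant"
  by (simp add: pos_part_def nonneg_orthant_def)

lemma neg_part_nonpos: "- neg_part c \<in> nonneg_orthant"
  by (simp add: neg_part_def nonneg_orthant_def)

lemma nonneg_orthant_inner:
  "x \<in> nonneg_orthant \<Longrightarrow> y \<in> nonneg_orthant \<Longrightarrow> 0 \<le> x \<bullet> y"
  by (simp add: nonneg_orthant_def inner_vec_def sum_nonneg)

lemma nonneg_orthant_scaleR: "x \<in> nonneg_orthant \<Longrightarrow> 0 \<le> a \<Longrightarrow> a *\<^sub>R x \<in> nonneg_orthant"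
  by (simp add: nonneg_orthant_def)

lemma nonneg_orthant_sgn: "x \<in> nonneg_orthant \<Longrightarrow> sgn x \<in> nonneg_orthant"
  by (simp add: sgn_div_norm nonneg_orthant_scaleR)

lemma sgn_inner_self: "sgn (x :: 'a :: real_inner) \<bullet> x = norm x"
  by (cases "x = 0") (auto simp: sgn_div_norm power2_norm_eq_inner[symmetric] power2_eq_square)

lemma norm_sgn_le_1: "norm (sgn (x :: 'a :: real_normed_vector)) \<le> 1"
  by (simp add: norm_sgn)

lemma sgn_neg_part_inner: "sgn (neg_part c) \<bullet> c = norm (neg_part c)"
proof -
  have "sgn (neg_part c) \<bullet> c = sgn (neg_part c) \<bullet> pos_part c + sgn (neg_part c) \<bullet> neg_part c"
    by (metis inner_add_right pos_part_add_neg_part)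
  moreover have "sgn (neg_part c) \<bullet> pos_part c = 0"
    using pos_part_inner_neg_part[of c] by (simp add: sgn_div_norm inner_commute)
  ultimately show ?thesis by (simp add: sgn_inner_self)
qed

lemma sgn_pos_part_inner: "sgn (pos_part c) \<bullet> c = norm (pos_part c)"
proof -
  have "sgn (pos_part c) \<bullet> c = sgn (pos_part c) \<bullet> pos_part c + sgn (pos_part c) \<bullet> neg_part c"
    by (metis inner_add_right pos_part_add_neg_part)
  moreover have "sgn (pos_part c) \<bullet> neg_part c = 0"
    using pos_part_inner_neg_part[of c] by (simp add: sgn_div_norm)
  ultimately show ?thesis by (simp add: sgn_inner_self)
qed

locale online_problem =
  fixes \<alpha> R :: real and \<K> :: "(real ^ 'n) set" and \<O> :: "real ^ 'n \<Rightarrow> real ^ 'n"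
    and qp :: "(real ^ 'n) list \<Rightarrow> real ^ 'n \<Rightarrow> real list"
    and N :: "real ^ 'n \<Rightarrow> real \<Rightarrow> nat" and c c' :: real
  assumes \<alpha>_pos: "0 < \<alpha>" and R_pos: "0 < R"
    and K_nonempty: "\<K> \<noteq> {}" and K_nonneg: "\<K> \<subseteq> nonneg_orthant"
    and K_norm: "\<And>x. x \<in> \<K> \<Longrightarrow> norm x \<le> R"
    and approx: "approx_oracle \<alpha> \<K> \<O>"
    and qp: "\<And>vs x. vs \<noteq> [] \<Longrightarrow> optimal_weights vs x (qp vs x)"
    and c_ge: "16 \<le> c" and N: "iteration_count c c' \<alpha> R N"
begin

lemma abs_inner_le: "x \<in> \<K> \<Longrightarrow> \<bar>x \<bullet> g\<bar> \<le> R * norm g"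
  by (rule order_trans[OF Cauchy_Schwarz_ineq2]) (simp add: K_norm mult_right_mono)

lemma bdd_below_inner: "bdd_below ((\<lambda>x. x \<bullet> g) ` \<K>)"
  using abs_inner_le[of _ g] by (intro bdd_belowI[of _ "- (R * norm g)"]) force

lemma bdd_above_inner: "bdd_above ((\<lambda>x. x \<bullet> g) ` \<K>)"
  using abs_inner_le[of _ g] by (intro bdd_aboveI[of _ "R * norm g"]) force

lemma oracle_in: "g \<in> nonneg_orthant \<Longrightarrow> \<O> g \<in> \<K>"
  using approx by (simp add: approx_oracle_def)

lemma oracle_le:
  assumes "1 \<le> \<alpha>" "g \<in> nonneg_orthant" "x \<in> \<K>"
  shows "\<O> g \<bullet> g \<le> \<alpha> * (x \<bullet> g)"
proof -
  have "\<O> g \<bullet> g \<le> \<alpha> * (INF x\<in>\<K>. x \<bullet> g)"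
    using approx assms by (simp add: approx_oracle_def)
  also have "\<dots> \<le> \<alpha> * (x \<bullet> g)"
    using \<alpha>_pos assms by (intro mult_left_mono cINF_lower bdd_below_inner) auto
  finally show ?thesis .
qed

lemma oracle_ge:
  assumes "\<alpha> < 1" "g \<in> nonneg_orthant" "x \<in> \<K>"
  shows "\<alpha> * (x \<bullet> g) \<le> \<O> g \<bullet> g"
proof -
  have "\<alpha> * (x \<bullet> g) \<le> \<alpha> * (SUP x\<in>\<K>. x \<bullet> g)"
    using \<alpha>_pos assms by (intro mult_left_mono cSUP_upper bdd_above_inner) auto
  also have "\<dots> \<le> \<O> g \<bullet> g"
    using approx assms by (simp add: approx_oracle_def)
  finally show ?thesis .
qed

text \<open>The two branches give (\<alpha> + 1) R and 2 R. The common bound puts every output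
  within twice \<open>(\<alpha> + 1) * R + norm x\<close> of x.\<close>

lemma extended_oracle_norm: "norm (fst (extended_oracle \<alpha> R \<O> g)) \<le> 2 * ((\<alpha> + 1) * R)"
proof -
  have le: "norm (s - a *\<^sub>R sgn z) \<le> R + a" if "s \<in> \<K>" "0 \<le> a" for s z :: "real ^ 'n" and a
  proof -
    have "norm (s - a *\<^sub>R sgn z) \<le> norm s + norm (a *\<^sub>R sgn z)" by (rule norm_triangle_ineq4)
    also have "norm (a *\<^sub>R sgn z) \<le> a"
      using that(2) mult_left_mono[OF norm_sgn_le_1 that(2), of z] by simp
    finally show ?thesis using K_norm[OF that(1)] by simp
  qed
  have "0 < \<alpha> * R" using \<alpha>_pos R_pos by simp
  then show ?thesis
    using le[of "\<O> (pos_part g)" "\<alpha> * R" "neg_part g"] le[of "\<O> (- neg_part g)" R "pos_part g"]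
      oracle_in[OF pos_part_nonneg, of g] oracle_in[OF neg_part_nonpos, of g] R_pos
    by (auto simp: extended_oracle_def Let_def algebra_simps)
qed

text \<open>In direction g the output does at least as well as all of \<alpha> K. The oracle
  controls one part of g, where its guarantee applies; the correction by a normalised vector
  subtracts a multiple of the norm of the other part, which by Cauchy-Schwarz outweighs whatever a
  point of norm at most R can contribute there.\<close>

lemma extended_oracle_inner_le:
  assumes x: "x \<in> \<K>"
  shows "fst (extended_oracle \<alpha> R \<O> g) \<bullet> g \<le> \<alpha> * (x \<bullet> g)"
proof -
  have split: "y \<bullet> g = y \<bullet> pos_part g + y \<bullet> neg_part g" for y
    by (metis inner_add_right pos_part_add_neg_part)
  have K: "0 \<le> y \<bullet> pos_part g" "y \<bullet> neg_part g \<le> 0" if "y \<in> \<K>" for y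
    using nonneg_orthant_inner[of y] that K_nonneg pos_part_nonneg neg_part_nonpos[of g] by force+
  show ?thesis
  proof (cases "1 \<le> \<alpha>")
    case True
    define s where "s = \<O> (pos_part g)"
    have s: "s \<in> \<K>" by (simp add: s_def oracle_in pos_part_nonneg)
    have "fst (extended_oracle \<alpha> R \<O> g) \<bullet> g = s \<bullet> g - \<alpha> * (R * norm (neg_part g))"
      using True by (simp add: extended_oracle_def Let_def s_def inner_diff_left sgn_neg_part_inner)
    also have "\<dots> \<le> s \<bullet> pos_part g + \<alpha> * (x \<bullet> neg_part g)"
    proof -
      have "\<alpha> * - (R * norm (neg_part g)) \<le> \<alpha> * (x \<bullet> neg_part g)"
        using abs_inner_le[OF x, of "neg_part g"] \<alpha>_pos by (intro mult_left_mono) auto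
      then show ?thesis using K(2)[OF s] split[of s] by simp
    qed
    also have "s \<bullet> pos_part g \<le> \<alpha> * (x \<bullet> pos_part g)"
      unfolding s_def by (rule oracle_le[OF True pos_part_nonneg x])
    finally show ?thesis using split[of x] by (simp add: algebra_simps)
  next
    case False
    define s where "s = \<O> (- neg_part g)"
    have s: "s \<in> \<K>" by (simp add: s_def oracle_in neg_part_nonpos)
    have "fst (extended_oracle \<alpha> R \<O> g) \<bullet> g = s \<bullet> g - R * norm (pos_part g)"
      using False by (simp add: extended_oracle_def Let_def s_def inner_diff_left sgn_pos_part_inner)
    also have "\<dots> \<le> s \<bullet> neg_part g"
      using abs_inner_le[OF s, of "pos_part g"] split[of s] by simp
    also have "\<dots> \<le> \<alpha> * (x \<bullet> neg_part g)"
      using oracle_ge[OF _ neg_part_nonpos x, of g] False by (simp add: s_def)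
    also have "\<dots> \<le> \<alpha> * (x \<bullet> g)"
      using \<alpha>_pos K(1)[OF x] split[of x] by (intro mult_left_mono) auto
    finally show ?thesis .
  qed
qed

text \<open>The correction moves v away from s by a vector of constant sign, upwards for losses and
  downwards for payoffs, so playing s is never worse than v.\<close>

lemma extended_oracle_dominates:
  assumes "h \<in> nonneg_orthant" "(v, s) = extended_oracle \<alpha> R \<O> g"
  shows "1 \<le> \<alpha> \<Longrightarrow> s \<bullet> h \<le> v \<bullet> h" and "\<alpha> < 1 \<Longrightarrow> v \<bullet> h \<le> s \<bullet> h"
proof -
  have "sgn (neg_part g) \<bullet> h \<le> 0"
    using nonneg_orthant_inner[OF nonneg_orthant_sgn[OF neg_part_nonpos] assms(1), of g]
    by (simp add: sgn_minus)
  moreover have "0 \<le> sgn (pos_part g) \<bullet> h"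
    by (rule nonneg_orthant_inner[OF nonneg_orthant_sgn[OF pos_part_nonneg] assms(1)])
  ultimately show "1 \<le> \<alpha> \<Longrightarrow> s \<bullet> h \<le> v \<bullet> h" "\<alpha> < 1 \<Longrightarrow> v \<bullet> h \<le> s \<bullet> h"
    using assms(2) \<alpha>_pos R_pos
    by (auto simp: extended_oracle_def Let_def inner_diff_left mult_le_0_iff)
qed

subsection \<open>Separation or decomposition\<close>

text \<open>One oracle answer certifies separation from the whole set: the query at -w returns v
  with \<open>\<alpha> * (z \<bullet> w) \<le> v \<bullet> w\<close> for every z in K.\<close>

lemma sep_or_decomp_Hyperplane:
  assumes "sep_or_decomp \<alpha> R \<O> qp N \<epsilon> x = (Hyperplane w, m)" and z: "z \<in> \<K>"
  shows "norm w \<le> 1" and "\<epsilon> \<le> (x - \<alpha> *\<^sub>R z) \<bullet> w"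
proof -
  have "fst (ellipsoid_run \<alpha> R \<O> x \<epsilon> (N x \<epsilon>) (0, mat 1) []) = Some w"
    using assms(1) by (auto simp: sep_or_decomp_def split: prod.splits option.splits)
  from ellipsoid_run_Some[OF this]
  have w: "norm w \<le> 1" "\<epsilon> \<le> (x - fst (extended_oracle \<alpha> R \<O> (- w))) \<bullet> w" by auto
  show "norm w \<le> 1" by (rule w)
  show "\<epsilon> \<le> (x - \<alpha> *\<^sub>R z) \<bullet> w"
    using w(2) extended_oracle_inner_le[OF z, of "- w"] by (simp add: inner_diff_left)
qed

lemma sep_or_decomp_calls: "snd (sep_or_decomp \<alpha> R \<O> qp N \<epsilon> x) \<le> N x \<epsilon>"
  using ellipsoid_run_length[of \<alpha> R \<O> x \<epsilon> "N x \<epsilon>" "(0, mat 1)" "[]"]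
  by (auto simp: sep_or_decomp_def split: prod.splits option.splits)

lemma N_pos: "0 < \<epsilon> \<Longrightarrow> 0 < N x \<epsilon>"
  using N by (simp add: iteration_count_def)

end

text \<open>This is the variational inequality of the nearest point. Moving weight towards index k
  stays feasible, so p is nearest to x on the whole segment from p to \<open>vs ! k\<close>.\<close>

lemma optimal_weights_inner_le:
  assumes a: "optimal_weights vs x a" and k: "k < length vs"
  defines "p \<equiv> \<Sum>i<length vs. a ! i *\<^sub>R vs ! i"
  shows "(x - p) \<bullet> (vs ! k - p) \<le> 0"
proof (rule any_closest_point_dot)
  have feas: "length a = length vs" "\<forall>i<length vs. 0 \<le> a ! i" "(\<Sum>i<length vs. a ! i) = 1"
    using a by (auto simp: optimal_weights_def is_arg_min_def)
  show "\<forall>z\<in>closed_segment p (vs ! k). dist x p \<le> dist x z"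
  proof
    fix z assume "z \<in> closed_segment p (vs ! k)"
    then obtain u where u: "0 \<le> u" "u \<le> 1" "z = (1 - u) *\<^sub>R p + u *\<^sub>R vs ! k"
      by (auto simp: closed_segment_def)
    define b where "b = map (\<lambda>i. (1 - u) * a ! i + (if i = k then u else 0)) [0..<length vs]"
    have "(\<Sum>i<length vs. b ! i) = 1"
      using k feas by (simp add: b_def sum.distrib sum_distrib_left[symmetric])
    moreover have "length b = length vs" "\<forall>i<length vs. 0 \<le> b ! i"
      using feas u by (auto simp: b_def)
    ultimately have "1 / 2 * (norm (p - x))\<^sup>2 \<le>
        1 / 2 * (norm ((\<Sum>i<length vs. b ! i *\<^sub>R vs ! i) - x))\<^sup>2"
      using a unfolding optimal_weights_def is_arg_min_linorder p_def by blast
    also have "(\<Sum>i<length vs. b ! i *\<^sub>R vs ! i) = z"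
    proof -
      have "(\<Sum>i<length vs. b ! i *\<^sub>R vs ! i) =
          (\<Sum>i<length vs. (1 - u) *\<^sub>R a ! i *\<^sub>R vs ! i + (if i = k then u *\<^sub>R vs ! i else 0))"
        by (rule sum.cong) (auto simp: b_def scaleR_add_left)
      also have "\<dots> = z"
        using k by (simp add: sum.distrib u(3) p_def scaleR_sum_right)
      finally show ?thesis .
    qed
    finally show "dist x p \<le> dist x z"
      by (simp add: dist_norm norm_minus_commute)
  qed
qed auto

context online_problem
begin

lemma sep_or_decomp_Decomposition:
  assumes \<epsilon>: "0 < \<epsilon>" and res: "sep_or_decomp \<alpha> R \<O> qp N \<epsilon> x = (Decomposition a ps, m)"
  shows "length a = length ps" "\<And>i. i < length ps \<Longrightarrow> 0 \<le> a ! i" "(\<Sum>i<length ps. a ! i) = 1"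
    and "set ps \<subseteq> range (extended_oracle \<alpha> R \<O>)"
    and "norm ((\<Sum>i<length ps. a ! i *\<^sub>R fst (ps ! i)) - x) \<le> 3 * \<epsilon>"
proof -
  have run: "ellipsoid_run \<alpha> R \<O> x \<epsilon> (N x \<epsilon>) (0, mat 1) [] = (None, ps)"
    and a: "a = qp (map fst ps) x"
    using res by (auto simp: sep_or_decomp_def split: prod.splits option.splits)
  have len: "length ps = N x \<epsilon>"
    using ellipsoid_run_length_None[of \<alpha> R \<O> x \<epsilon> "N x \<epsilon>" "(0, mat 1)" "[]"] run by simp
  show ps: "set ps \<subseteq> range (extended_oracle \<alpha> R \<O>)"
    using ellipsoid_run_range[of \<alpha> R \<O> x \<epsilon> "N x \<epsilon>" "(0, mat 1)" "[]"] run by simp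
  have "map fst ps \<noteq> []" using len N_pos[OF \<epsilon>, of x] by auto
  from qp[OF this] have opt: "optimal_weights (map fst ps) x a" by (simp add: a)
  then show feas: "length a = length ps" "\<And>i. i < length ps \<Longrightarrow> 0 \<le> a ! i"
    "(\<Sum>i<length ps. a ! i) = 1"
    by (auto simp: optimal_weights_def is_arg_min_def)
  define p where "p = (\<Sum>i<length ps. a ! i *\<^sub>R fst (ps ! i))"
  have p_eq: "p = (\<Sum>i<length (map fst ps). a ! i *\<^sub>R map fst ps ! i)"
    by (simp add: p_def)
  define Q where "Q = (\<alpha> + 1) * R + norm x"
  have Q: "0 < Q" using \<alpha>_pos R_pos by (auto simp: Q_def intro!: add_pos_nonneg)
  have far: "norm (x - v) \<le> 2 * Q" if v: "(v, s) \<in> set ps" for v s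
  proof -
    obtain g where "(v, s) = extended_oracle \<alpha> R \<O> g" using v ps by auto
    then have "norm v \<le> 2 * ((\<alpha> + 1) * R)" using extended_oracle_norm[of g] by (metis fst_conv)
    moreover have "norm (x - v) \<le> norm x + norm v" by (rule norm_triangle_ineq4)
    moreover have "2 * Q = 2 * ((\<alpha> + 1) * R) + 2 * norm x" by (simp add: Q_def)
    ultimately show ?thesis
      using norm_ge_zero[of x] by linarith
  qed
  show "norm ((\<Sum>i<length ps. a ! i *\<^sub>R fst (ps ! i)) - x) \<le> 3 * \<epsilon>"
  proof (rule ccontr)
    assume "\<not> ?thesis"
    then have gt: "3 * \<epsilon> < norm (x - p)" by (simp add: p_def norm_minus_commute)
    define u where "u = (1 / norm (x - p)) *\<^sub>R (x - p)"
    have np: "0 < norm (x - p)" using gt \<epsilon> by linarith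
    then have u: "norm u = 1" by (simp add: u_def)
    have vu: "norm (x - p) \<le> (x - v) \<bullet> u" if v: "(v, s) \<in> set ps" for v s
    proof -
      obtain k where k: "k < length ps" "ps ! k = (v, s)" using v by (auto simp: in_set_conv_nth)
      then have "(x - p) \<bullet> (v - p) \<le> 0"
        using optimal_weights_inner_le[OF opt, of k] by (simp add: p_def)
      then have "(norm (x - p))\<^sup>2 \<le> (x - v) \<bullet> (x - p)"
        by (simp add: power2_norm_eq_inner inner_simps inner_commute)
      then have "norm (x - p) \<le> (x - v) \<bullet> (x - p) / norm (x - p)"
        using np by (simp only: pos_le_divide_eq power2_eq_square)
      also have "\<dots> = (x - v) \<bullet> u" by (simp only: u_def inner_scaleR_right) simp
      finally show ?thesis .
    qed
    \<comment> \<open>A combination at distance more than 3 \<epsilon> is possible only if 3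
      \<epsilon> < 2 Q. This keeps q, and hence the logarithm in the iteration count, away from the
      degenerate range.\<close>
    obtain v0 s0 where "(v0, s0) \<in> set ps"
      using \<open>map fst ps \<noteq> []\<close> by (cases ps) auto
    then have "norm (x - p) \<le> 2 * Q"
      using vu far Cauchy_Schwarz_ineq2[of "x - v0" u] u by (fastforce intro: order_trans)
    with gt have Qe: "3 / 2 < Q / \<epsilon>" using \<epsilon> by (simp add: field_simps)
    define q where "q = Q / \<epsilon>"
    have q: "3 / 2 < q" using Qe by (simp add: q_def)
    \<comment> \<open>This r solves (1 - r) 3 \<epsilon> - 2 Q r = \<epsilon>: the margin 3
      \<epsilon> of u, scaled by 1 - r to make room in the unit ball, minus the loss over a ball of
      radius r.\<close>
    define r where "r = 1 / (3 / 2 + q)"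
    have r: "0 < r" "r \<le> 1" using q by (auto simp: r_def)
    have bound: "real (N x \<epsilon>) \<le> 2 * (real CARD('n) + 1) * real CARD('n) * ln (1 / r)"
    proof (rule ellipsoid_run_radius_bound[OF r(1) _ \<epsilon> run])
      show "cball ((1 - r) *\<^sub>R u) r \<subseteq> cball 0 1"
        using r u by (simp add: cball_subset_cball_iff dist_norm)
      fix v s z assume v: "(v, s) \<in> set ps" and "z \<in> cball ((1 - r) *\<^sub>R u) r"
      then have z: "norm ((1 - r) *\<^sub>R u - z) \<le> r" by (simp add: dist_norm)
      have "\<bar>(x - v) \<bullet> ((1 - r) *\<^sub>R u - z)\<bar> \<le> norm (x - v) * norm ((1 - r) *\<^sub>R u - z)"
        by (rule Cauchy_Schwarz_ineq2)
      also have "\<dots> \<le> 2 * Q * r"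
        using far[OF v] z Q by (intro mult_mono) auto
      finally have "(1 - r) * ((x - v) \<bullet> u) - 2 * Q * r \<le> (x - v) \<bullet> z"
        by (simp add: inner_diff_right)
      moreover have "(1 - r) * (3 * \<epsilon>) \<le> (1 - r) * ((x - v) \<bullet> u)"
        using vu[OF v] gt r by (intro mult_left_mono) auto
      moreover have "(1 - r) * (3 * \<epsilon>) - 2 * Q * r = \<epsilon>"
      proof -
        have "r * (3 / 2 + q) = 1" using q by (simp add: r_def)
        then have "2 * \<epsilon> = 2 * \<epsilon> * (r * (3 / 2 + q))" by simp
        also have "\<dots> = r * (3 * \<epsilon> + 2 * (q * \<epsilon>))" by (simp add: algebra_simps)
        finally have "2 * \<epsilon> = r * (3 * \<epsilon> + 2 * (q * \<epsilon>))" .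
        moreover have "q * \<epsilon> = Q" using \<epsilon> by (simp add: q_def)
        ultimately show ?thesis by (simp add: algebra_simps)
      qed
      ultimately show "\<epsilon> \<le> (x - v) \<bullet> z" by linarith
    qed
    \<comment> \<open>The additive constant in 1 / r is absorbed into a power of q, so that only ln
      q remains, as in the iteration count.\<close>
    have "3 / 2 + q < q ^ 4"
    proof -
      have "(3 / 2) ^ 3 \<le> q ^ 3" using q by (intro power_mono) auto
      then have "27 / 8 * q \<le> q ^ 3 * q" using q by (intro mult_right_mono) (auto simp: power3_eq_cube)
      then have "27 / 8 * q \<le> q ^ 4" by (simp add: eval_nat_numeral mult_ac)
      then show ?thesis using q by linarith
    qed
    then have "ln (1 / r) < ln (q ^ 4)"
      using q by (subst ln_less_cancel_iff) (auto simp: r_def)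
    then have ln: "ln (1 / r) < 4 * ln q" using q by (simp add: ln_realpow)
    define d where "d = real CARD('n)"
    have d: "1 \<le> d" by (simp add: d_def)
    have "0 < ln q" using q by simp
    \<comment> \<open>The constant 16 is 4 times 4:
      \<open>2 * (d + 1) * d \<le> 4 * d\<^sup>2\<close> and
      \<open>ln (1 / r) < 4 * ln q\<close>.\<close>
    have "16 * (d\<^sup>2 * ln q) \<le> c * (d\<^sup>2 * ln q)"
      using c_ge \<open>0 < ln q\<close> by (intro mult_right_mono) auto
    also have "\<dots> \<le> real (N x \<epsilon>)"
      using N \<epsilon> by (auto simp: iteration_count_def d_def q_def Q_def mult_ac)
    also have "\<dots> \<le> 2 * (d + 1) * d * ln (1 / r)"
      using bound by (simp add: d_def)
    also have "\<dots> < 2 * (d + 1) * d * (4 * ln q)"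
      using d ln by (intro mult_strict_left_mono) auto
    also have "\<dots> \<le> (4 * d\<^sup>2) * (4 * ln q)"
      using d \<open>0 < ln q\<close> by (intro mult_right_mono) (auto simp: power2_eq_square algebra_simps)
    finally show False by simp
  qed
qed

end

subsection \<open>The projection loop\<close>

text \<open>With scaling factor l < 1 the squared distances differ by
  \<open>(1 - l) * ((1 + l) * (y \<bullet> y) - 2 * (y \<bullet> z))\<close>, which is nonnegative
  since \<open>y \<bullet> z \<le> l * (y \<bullet> y)\<close>.\<close>

lemma norm_radial_projection_diff_le:
  fixes y z :: "'a :: real_inner"
  assumes r: "0 < r" and z: "norm z \<le> r"
  shows "norm (y /\<^sub>R max 1 (norm y / r) - z) \<le> norm (y - z)"
proof (cases "norm y \<le> r")
  case True
  then have "max 1 (norm y / r) = 1" using r by (simp add: max_def)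
  then show ?thesis by simp
next
  case False
  define l where "l = r / norm y"
  have y: "0 < norm y" using False r by linarith
  have l: "0 < l" "l < 1" "r = l * norm y" using False r y by (auto simp: l_def)
  have "max 1 (norm y / r) = norm y / r" using False r by (simp add: max_def field_simps)
  then have eq: "y /\<^sub>R max 1 (norm y / r) = l *\<^sub>R y" by (simp add: l_def)
  have "y \<bullet> z \<le> norm y * norm z" by (rule norm_cauchy_schwarz)
  also have "\<dots> \<le> norm y * r" using z by (intro mult_left_mono) auto
  also have "\<dots> = l * (y \<bullet> y)" by (simp add: l(3) power2_norm_eq_inner[symmetric] power2_eq_square)
  finally have yz: "y \<bullet> z \<le> l * (y \<bullet> y)" .
  have "2 * l * (y \<bullet> y) \<le> (1 + l) * (y \<bullet> y)"
    using l by (intro mult_right_mono) auto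
  then have "0 \<le> (1 - l) * ((1 + l) * (y \<bullet> y) - 2 * (y \<bullet> z))"
    using l yz by (intro mult_nonneg_nonneg) auto
  also have "\<dots> = (norm (y - z))\<^sup>2 - (norm (l *\<^sub>R y - z))\<^sup>2"
    unfolding power2_norm_eq_inner by (simp add: inner_simps inner_commute algebra_simps)
  finally have "(norm (l *\<^sub>R y - z))\<^sup>2 \<le> (norm (y - z))\<^sup>2" by simp
  then show ?thesis unfolding eq by (rule power2_le_imp_le) simp
qed

lemma norm_radial_projection_le:
  fixes y :: "'a :: real_inner"
  assumes r: "0 < r"
  shows "norm (y /\<^sub>R max 1 (norm y / r)) \<le> r"
proof (cases "norm y \<le> r")
  case True
  then have "max 1 (norm y / r) = 1" using r by (simp add: max_def)
  then show ?thesis using True by simp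
next
  case False
  then have "max 1 (norm y / r) = norm y / r" using r by (simp add: max_def field_simps)
  then show ?thesis using r False by (auto simp: field_simps)
qed

context online_problem
begin

lemma separation_step:
  assumes \<epsilon>: "0 < \<epsilon>" and "sep_or_decomp \<alpha> R \<O> qp N \<epsilon> y = (Hyperplane w, m)" "x \<in> \<K>"
  shows "(norm (y - \<epsilon> *\<^sub>R w - \<alpha> *\<^sub>R x))\<^sup>2 + \<epsilon>\<^sup>2 \<le> (norm (y - \<alpha> *\<^sub>R x))\<^sup>2"
proof -
  have w: "norm w \<le> 1" "\<epsilon> \<le> (y - \<alpha> *\<^sub>R x) \<bullet> w"
    using sep_or_decomp_Hyperplane[OF assms(2,3)] by auto
  have "w \<bullet> w \<le> 1" using w(1) by (simp add: norm_le_square[symmetric] power2_norm_eq_inner[symmetric] power_le_one)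
  then have "\<epsilon>\<^sup>2 * (w \<bullet> w) \<le> \<epsilon>\<^sup>2" by (simp add: mult_left_le)
  moreover have "2 * \<epsilon> * \<epsilon> \<le> 2 * \<epsilon> * ((y - \<alpha> *\<^sub>R x) \<bullet> w)"
    using w(2) \<epsilon> by (intro mult_left_mono) auto
  moreover have "(norm (y - \<epsilon> *\<^sub>R w - \<alpha> *\<^sub>R x))\<^sup>2 =
      (norm (y - \<alpha> *\<^sub>R x))\<^sup>2 - 2 * \<epsilon> * ((y - \<alpha> *\<^sub>R x) \<bullet> w) + \<epsilon>\<^sup>2 * (w \<bullet> w)"
    unfolding power2_norm_eq_inner by (simp add: inner_simps inner_commute algebra_simps power2_eq_square)
  ultimately show ?thesis by (simp add: power2_eq_square)
qed

text \<open>The squared distance to one reference point z, in units of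
  \<open>\<epsilon>\<^sup>2\<close>, is the fuel k of the induction. The actual number j of
  hyperplane steps is kept apart from k, as the amortised count needs it; the extra 1 is the final
  call, which returns the decomposition. Distances to \<alpha> z never grow, so one bound B covers
  all calls.\<close>

lemma projection_loop_terminates:
  fixes B :: real
  assumes \<epsilon>: "0 < \<epsilon>" and z: "z \<in> \<K>"
  shows "(norm (y - \<alpha> *\<^sub>R z))\<^sup>2 \<le> real k * \<epsilon>\<^sup>2 \<Longrightarrow>
    (\<And>x. norm (x - \<alpha> *\<^sub>R z) \<le> norm (y - \<alpha> *\<^sub>R z) \<Longrightarrow> real (N x \<epsilon>) \<le> B) \<Longrightarrow>
    \<exists>y' a ps m m' j. projection_loop \<alpha> R \<O> qp N \<epsilon> y n = Some (y', a, ps, n + m) \<and>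
      sep_or_decomp \<alpha> R \<O> qp N \<epsilon> y' = (Decomposition a ps, m') \<and>
      (\<forall>x\<in>\<K>. (norm (y' - \<alpha> *\<^sub>R x))\<^sup>2 + real j * \<epsilon>\<^sup>2 \<le> (norm (y - \<alpha> *\<^sub>R x))\<^sup>2) \<and>
      real m \<le> (real j + 1) * B"
proof (induction k arbitrary: y n)
  case (0 y n)
  obtain r m0 where r: "sep_or_decomp \<alpha> R \<O> qp N \<epsilon> y = (r, m0)" by (meson surj_pair)
  have "real m0 \<le> B"
    using 0(2)[of y] sep_or_decomp_calls[of \<epsilon> y] r by simp
  show ?case
  proof (cases r)
    case (Hyperplane w)
    have "(norm (y - \<alpha> *\<^sub>R z))\<^sup>2 \<le> 0" using 0(1) by simp
    moreover have "0 \<le> (norm (y - \<epsilon> *\<^sub>R w - \<alpha> *\<^sub>R z))\<^sup>2" by (rule zero_le_power2)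
    ultimately have "\<epsilon>\<^sup>2 \<le> 0"
      using separation_step[OF \<epsilon> r[unfolded Hyperplane] z] by linarith
    then show ?thesis using \<epsilon> by simp
  next
    case (Decomposition a ps)
    then show ?thesis
      using r \<open>real m0 \<le> B\<close>
      by (intro exI[of _ y] exI[of _ a] exI[of _ ps] exI[of _ m0] exI[of _ "0::nat"])
        (simp add: projection_loop.simps)
  qed
next
  case (Suc k y n)
  obtain r m0 where r: "sep_or_decomp \<alpha> R \<O> qp N \<epsilon> y = (r, m0)" by (meson surj_pair)
  have m0: "real m0 \<le> B"
    using Suc(3)[of y] sep_or_decomp_calls[of \<epsilon> y] r by simp
  show ?case
  proof (cases r)
    case (Hyperplane w)
    define y1 where "y1 = y - \<epsilon> *\<^sub>R w"
    have step: "(norm (y1 - \<alpha> *\<^sub>R x))\<^sup>2 + \<epsilon>\<^sup>2 \<le> (norm (y - \<alpha> *\<^sub>R x))\<^sup>2" if "x \<in> \<K>" for x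
      using separation_step[OF \<epsilon> r[unfolded Hyperplane] that] by (simp add: y1_def)
    have k: "(norm (y1 - \<alpha> *\<^sub>R z))\<^sup>2 \<le> real k * \<epsilon>\<^sup>2"
      using step[OF z] Suc.prems(1) by (simp add: algebra_simps)
    have "norm (y1 - \<alpha> *\<^sub>R z) \<le> norm (y - \<alpha> *\<^sub>R z)"
    proof (rule power2_le_imp_le)
      show "(norm (y1 - \<alpha> *\<^sub>R z))\<^sup>2 \<le> (norm (y - \<alpha> *\<^sub>R z))\<^sup>2"
        using step[OF z] zero_le_power2[of \<epsilon>] by linarith
    qed simp
    then have N1: "real (N x \<epsilon>) \<le> B" if "norm (x - \<alpha> *\<^sub>R z) \<le> norm (y1 - \<alpha> *\<^sub>R z)" for x
      using Suc.prems(2)[of x] that by linarith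
    obtain y' a ps m m' j where IH:
      "projection_loop \<alpha> R \<O> qp N \<epsilon> y1 (n + m0) = Some (y', a, ps, n + m0 + m)"
      "sep_or_decomp \<alpha> R \<O> qp N \<epsilon> y' = (Decomposition a ps, m')"
      "\<forall>x\<in>\<K>. (norm (y' - \<alpha> *\<^sub>R x))\<^sup>2 + real j * \<epsilon>\<^sup>2 \<le> (norm (y1 - \<alpha> *\<^sub>R x))\<^sup>2"
      "real m \<le> (real j + 1) * B"
      using Suc.IH[OF k N1, of "n + m0"] by blast
    have "projection_loop \<alpha> R \<O> qp N \<epsilon> y n = Some (y', a, ps, n + (m0 + m))"
      using IH(1) by (subst projection_loop.simps) (simp add: r Hyperplane y1_def add.assoc)
    moreover have "\<forall>x\<in>\<K>. (norm (y' - \<alpha> *\<^sub>R x))\<^sup>2 + real (Suc j) * \<epsilon>\<^sup>2 \<le> (norm (y - \<alpha> *\<^sub>R x))\<^sup>2"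
    proof
      fix x assume x: "x \<in> \<K>"
      then have "(norm (y' - \<alpha> *\<^sub>R x))\<^sup>2 + real j * \<epsilon>\<^sup>2 \<le> (norm (y1 - \<alpha> *\<^sub>R x))\<^sup>2"
        using IH(3) by blast
      moreover have "real (Suc j) * \<epsilon>\<^sup>2 = real j * \<epsilon>\<^sup>2 + \<epsilon>\<^sup>2" by (simp add: algebra_simps)
      ultimately show "(norm (y' - \<alpha> *\<^sub>R x))\<^sup>2 + real (Suc j) * \<epsilon>\<^sup>2 \<le> (norm (y - \<alpha> *\<^sub>R x))\<^sup>2"
        using step[OF x] by linarith
    qed
    moreover have "real (m0 + m) \<le> (real (Suc j) + 1) * B"
      using IH(4) m0 by (simp add: algebra_simps)
    ultimately show ?thesis using IH(2) by blast
  next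
    case (Decomposition a ps)
    then show ?thesis
      using r m0
      by (intro exI[of _ y] exI[of _ a] exI[of _ ps] exI[of _ m0] exI[of _ "0::nat"])
        (simp add: projection_loop.simps)
  qed
qed

lemma c'_pos: "0 < c'"
proof -
  have "0 < real (N 0 1)" using N_pos[of 1 0] by simp
  also have "\<dots> \<le> c' * (real CARD('n))\<^sup>2 * max 1 (ln (((\<alpha> + 1) * R + norm (0 :: real ^ 'n)) / 1))"
    using N unfolding iteration_count_def by (metis zero_less_one)
  finally show ?thesis
    by (smt (verit) max.cobounded1 mult_nonpos_nonneg zero_le_power2)
qed

definition calls_per_step :: "real \<Rightarrow> real" where
  "calls_per_step \<epsilon> = 12 / 5 * c' * (real CARD('n))\<^sup>2 * max 1 (ln ((\<alpha> + 1) * R / \<epsilon>))"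

text \<open>The iterates stay in the ball of radius \<open>3 \<alpha> R\<close>, and \<open>1 + ln 4 \<le> 12 / 5\<close>.\<close>

lemma N_le_calls_per_step:
  assumes \<epsilon>: "0 < \<epsilon>" and x: "norm x \<le> 3 * (\<alpha> * R)"
  shows "real (N x \<epsilon>) \<le> calls_per_step \<epsilon>"
proof -
  define L where "L = max 1 (ln ((\<alpha> + 1) * R / \<epsilon>))"
  have aR: "0 < \<alpha> * R" "0 < (\<alpha> + 1) * R" using \<alpha>_pos R_pos by auto
  have "(\<alpha> + 1) * R + norm x \<le> 4 * ((\<alpha> + 1) * R)"
    using x R_pos by (simp add: algebra_simps)
  then have "((\<alpha> + 1) * R + norm x) / \<epsilon> \<le> 4 * ((\<alpha> + 1) * R) / \<epsilon>"
    using \<epsilon> by (simp add: divide_right_mono)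
  then have "ln (((\<alpha> + 1) * R + norm x) / \<epsilon>) \<le> ln (4 * ((\<alpha> + 1) * R / \<epsilon>))"
    using aR \<epsilon> by (subst ln_le_cancel_iff) (auto intro!: divide_pos_pos add_pos_nonneg simp del: zero_less_mult_iff)
  also have "\<dots> = ln 4 + ln ((\<alpha> + 1) * R / \<epsilon>)"
    using aR \<epsilon> by (intro ln_mult_pos) (auto simp del: zero_less_mult_iff)
  also have "ln 4 = 2 * ln (2::real)" using ln_realpow[of 2 2] by simp
  also have "2 * ln 2 \<le> (7 / 5 :: real)" using ln2_le_25_over_36 by simp
  finally have "max 1 (ln (((\<alpha> + 1) * R + norm x) / \<epsilon>)) \<le> 12 / 5 * L"
    unfolding L_def by linarith
  moreover have "real (N x \<epsilon>) \<le> c' * (real CARD('n))\<^sup>2 * max 1 (ln (((\<alpha> + 1) * R + norm x) / \<epsilon>))"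
    using N \<epsilon> by (simp add: iteration_count_def)
  ultimately have "real (N x \<epsilon>) \<le> c' * (real CARD('n))\<^sup>2 * (12 / 5 * L)"
    using c'_pos by (meson order_trans mult_left_mono mult_nonneg_nonneg less_imp_le zero_le_power2)
  then show ?thesis by (simp add: calls_per_step_def L_def mult_ac)
qed

text \<open>The initial rescaling brings the loop within 2 \<alpha> R of all of \<alpha> K without
  increasing any distance to it. Thus the calls cost the same however far y lies outside, while the
  decrease is still measured from y itself.\<close>

lemma projection_terminates:
  assumes \<epsilon>: "0 < \<epsilon>"
  obtains y' a ps m m' j where "projection \<alpha> R \<O> qp N \<epsilon> y = Some (y', a, ps, m)"
    and "sep_or_decomp \<alpha> R \<O> qp N \<epsilon> y' = (Decomposition a ps, m')"
    and "\<And>x. x \<in> \<K> \<Longrightarrow> (norm (y' - \<alpha> *\<^sub>R x))\<^sup>2 + real j * \<epsilon>\<^sup>2 \<le> (norm (y - \<alpha> *\<^sub>R x))\<^sup>2"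
    and "\<And>x. x \<in> \<K> \<Longrightarrow> norm (y' - \<alpha> *\<^sub>R x) \<le> 2 * (\<alpha> * R)"
    and "real m \<le> (real j + 1) * calls_per_step \<epsilon>"
proof -
  have aR: "0 < \<alpha> * R" using \<alpha>_pos R_pos by auto
  obtain z where z: "z \<in> \<K>" using K_nonempty by blast
  define y0 where "y0 = y /\<^sub>R max 1 (norm y / (\<alpha> * R))"
  have ax: "norm (\<alpha> *\<^sub>R x) \<le> \<alpha> * R" if "x \<in> \<K>" for x
    using K_norm[OF that] \<alpha>_pos by simp
  have near: "norm (y0 - \<alpha> *\<^sub>R x) \<le> 2 * (\<alpha> * R)" if "x \<in> \<K>" for x
    using norm_radial_projection_le[OF aR, of y] ax[OF that]
      norm_triangle_ineq4[of y0 "\<alpha> *\<^sub>R x"] by (simp add: y0_def)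
  have closer: "norm (y0 - \<alpha> *\<^sub>R x) \<le> norm (y - \<alpha> *\<^sub>R x)" if "x \<in> \<K>" for x
    unfolding y0_def by (rule norm_radial_projection_diff_le[OF aR ax[OF that]])
  obtain k where "(norm (y0 - \<alpha> *\<^sub>R z))\<^sup>2 / \<epsilon>\<^sup>2 \<le> real k"
    using real_arch_simple by blast
  then have k: "(norm (y0 - \<alpha> *\<^sub>R z))\<^sup>2 \<le> real k * \<epsilon>\<^sup>2"
    using \<epsilon> by (simp add: field_simps)
  have N_le: "real (N x \<epsilon>) \<le> calls_per_step \<epsilon>"
    if "norm (x - \<alpha> *\<^sub>R z) \<le> norm (y0 - \<alpha> *\<^sub>R z)" for x
  proof (rule N_le_calls_per_step[OF \<epsilon>])
    have "norm x \<le> norm (x - \<alpha> *\<^sub>R z) + norm (\<alpha> *\<^sub>R z)"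
      using norm_triangle_ineq[of "x - \<alpha> *\<^sub>R z" "\<alpha> *\<^sub>R z"] by simp
    then show "norm x \<le> 3 * (\<alpha> * R)"
      using that near[OF z] ax[OF z] by linarith
  qed
  obtain y' a ps m m' j where loop:
    "projection_loop \<alpha> R \<O> qp N \<epsilon> y0 0 = Some (y', a, ps, 0 + m)"
    "sep_or_decomp \<alpha> R \<O> qp N \<epsilon> y' = (Decomposition a ps, m')"
    "\<forall>x\<in>\<K>. (norm (y' - \<alpha> *\<^sub>R x))\<^sup>2 + real j * \<epsilon>\<^sup>2 \<le> (norm (y0 - \<alpha> *\<^sub>R x))\<^sup>2"
    "real m \<le> (real j + 1) * calls_per_step \<epsilon>"
    using projection_loop_terminates[OF \<epsilon> z k N_le] by blast
  show thesis
  proof (rule that)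
    show "projection \<alpha> R \<O> qp N \<epsilon> y = Some (y', a, ps, m)"
      using loop(1) by (simp add: projection_def y0_def)
    fix x assume x: "x \<in> \<K>"
    have *: "(norm (y' - \<alpha> *\<^sub>R x))\<^sup>2 + real j * \<epsilon>\<^sup>2 \<le> (norm (y0 - \<alpha> *\<^sub>R x))\<^sup>2"
      using loop(3) x by blast
    also have "\<dots> \<le> (norm (y - \<alpha> *\<^sub>R x))\<^sup>2"
      using closer[OF x] by (intro power_mono) auto
    finally show "(norm (y' - \<alpha> *\<^sub>R x))\<^sup>2 + real j * \<epsilon>\<^sup>2 \<le> (norm (y - \<alpha> *\<^sub>R x))\<^sup>2" .
    have "0 \<le> real j * \<epsilon>\<^sup>2" by simp
    then have "(norm (y' - \<alpha> *\<^sub>R x))\<^sup>2 \<le> (norm (y0 - \<alpha> *\<^sub>R x))\<^sup>2" using * by linarith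
    then show "norm (y' - \<alpha> *\<^sub>R x) \<le> 2 * (\<alpha> * R)"
      using near[OF x] power2_le_imp_le[of "norm (y' - \<alpha> *\<^sub>R x)" "norm (y0 - \<alpha> *\<^sub>R x)"] by simp
  qed (use loop in auto)
qed

end

subsection \<open>The full-information algorithm\<close>

text \<open>Repeated points of the list have their weights added in the distribution, hence the
  exchange of sums over points and positions.\<close>

lemma integral_pmf_of_list:
  fixes \<phi> :: "'a \<Rightarrow> real"
  assumes "pmf_of_list_wf xs"
  shows "(\<integral>x. \<phi> x \<partial>pmf_of_list xs) = (\<Sum>i<length xs. snd (xs ! i) * \<phi> (fst (xs ! i)))"
proof -
  define A where "A = set (map fst xs)"
  have sum: "pmf (pmf_of_list xs) x = (\<Sum>i<length xs. if fst (xs ! i) = x then snd (xs ! i) else 0)"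
    for x
    unfolding pmf_pmf_of_list[OF assms]
    by (subst sum_list_map_filter', subst sum_list_sum_nth) (simp add: atLeast0LessThan)
  have "(\<integral>x. \<phi> x \<partial>pmf_of_list xs) = (\<Sum>x\<in>A. \<phi> x * pmf (pmf_of_list xs) x)"
    using set_pmf_of_list[OF assms] by (intro integral_measure_pmf_real) (auto simp: A_def)
  also have "\<dots> = (\<Sum>x\<in>A. \<Sum>i<length xs. if x = fst (xs ! i) then \<phi> x * snd (xs ! i) else 0)"
    unfolding sum sum_distrib_left by (intro sum.cong) auto
  also have "\<dots> = (\<Sum>i<length xs. \<Sum>x\<in>A. if x = fst (xs ! i) then \<phi> x * snd (xs ! i) else 0)"
    by (rule sum.swap)
  also have "\<dots> = (\<Sum>i<length xs. snd (xs ! i) * \<phi> (fst (xs ! i)))"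
    by (intro sum.cong) (auto simp: A_def mult.commute)
  finally show ?thesis .
qed

lemma power2_norm_diff_scaleR:
  fixes u g :: "'a :: real_inner"
  shows "(norm (u - k *\<^sub>R g))\<^sup>2 = (norm u)\<^sup>2 - 2 * k * (u \<bullet> g) + k\<^sup>2 * (norm g)\<^sup>2"
  unfolding power2_norm_eq_inner
  by (simp add: inner_diff_left inner_diff_right inner_commute algebra_simps power2_eq_square)

text \<open>Vectors of the orthant form no obtuse angle. This saves a factor 2 over the triangle
  inequality and yields the constant 1 in the first term of the regret bound.\<close>

lemma norm_diff_nonneg_orthant:
  assumes "x \<in> nonneg_orthant" "y \<in> nonneg_orthant"
  shows "(norm (x - y))\<^sup>2 \<le> (norm x)\<^sup>2 + (norm y)\<^sup>2"
  using nonneg_orthant_inner[OF assms]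
  by (simp add: power2_norm_eq_inner inner_simps inner_commute)

text \<open>With this sign both update rules read
  \<open>y - (\<eta> * loss_sign \<alpha>) *\<^sub>R f t\<close>, and losses and payoffs share one
  analysis.\<close>

definition loss_sign :: "real \<Rightarrow> real" where
  "loss_sign \<alpha> = (if 1 \<le> \<alpha> then 1 else - 1)"

lemma loss_sign_cases: "loss_sign \<alpha> = 1 \<or> loss_sign \<alpha> = - 1"
  by (simp add: loss_sign_def)

context online_problem
begin

text \<open>The bound holds for every h in the orthant, because the point sampled here meets its
  loss vector only in the next round.\<close>

lemma decomposition_play:
  assumes \<epsilon>: "0 < \<epsilon>" and res: "sep_or_decomp \<alpha> R \<O> qp N \<epsilon> y = (Decomposition a ps, m)"
  defines "q \<equiv> pmf_of_list (zip (map snd ps) a)"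
  shows "finite (set_pmf q)"
    and "\<And>h. h \<in> nonneg_orthant \<Longrightarrow>
      loss_sign \<alpha> * (\<integral>s. s \<bullet> h \<partial>q) \<le> loss_sign \<alpha> * (y \<bullet> h) + 3 * \<epsilon> * norm h"
proof -
  note D = sep_or_decomp_Decomposition[OF \<epsilon> res]
  have "map snd (zip (map snd ps) a) = a" using D(1) by simp
  moreover have "0 \<le> w" if "w \<in> set a" for w
    using that D(1,2) by (auto simp: in_set_conv_nth)
  moreover have "sum_list a = 1"
    using D(1,3) by (simp add: sum_list_sum_nth atLeast0LessThan)
  ultimately have wf: "pmf_of_list_wf (zip (map snd ps) a)"
    unfolding pmf_of_list_wf_def by simp
  show "finite (set_pmf q)" unfolding q_def by (rule finite_set_pmf_of_list[OF wf])
  fix h :: "real ^ 'n" assume h: "h \<in> nonneg_orthant"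
  define p where "p = (\<Sum>i<length ps. a ! i *\<^sub>R fst (ps ! i))"
  have "(\<integral>s. s \<bullet> h \<partial>q) = (\<Sum>i<length ps. a ! i * (snd (ps ! i) \<bullet> h))"
    unfolding q_def integral_pmf_of_list[OF wf] using D(1) by simp
  then have "loss_sign \<alpha> * (\<integral>s. s \<bullet> h \<partial>q) =
      (\<Sum>i<length ps. a ! i * (loss_sign \<alpha> * (snd (ps ! i) \<bullet> h)))"
    by (simp add: sum_distrib_left mult_ac)
  also have "\<dots> \<le> (\<Sum>i<length ps. a ! i * (loss_sign \<alpha> * (fst (ps ! i) \<bullet> h)))"
  proof (rule sum_mono, rule mult_left_mono)
    fix i assume i: "i \<in> {..<length ps}"
    then obtain g where "ps ! i = extended_oracle \<alpha> R \<O> g"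
      using D(4) nth_mem by blast
    then have "(fst (ps ! i), snd (ps ! i)) = extended_oracle \<alpha> R \<O> g" by simp
    from extended_oracle_dominates[OF h this]
    show "loss_sign \<alpha> * (snd (ps ! i) \<bullet> h) \<le> loss_sign \<alpha> * (fst (ps ! i) \<bullet> h)"
      by (auto simp: loss_sign_def)
    show "0 \<le> a ! i" using D(2) i by simp
  qed
  also have "\<dots> = loss_sign \<alpha> * (p \<bullet> h)"
    by (simp add: p_def inner_sum_left sum_distrib_left mult_ac)
  also have "\<dots> = loss_sign \<alpha> * (y \<bullet> h) + loss_sign \<alpha> * ((p - y) \<bullet> h)"
    by (simp add: inner_diff_left algebra_simps)
  also have "loss_sign \<alpha> * ((p - y) \<bullet> h) \<le> \<bar>(p - y) \<bullet> h\<bar>"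
    using loss_sign_cases[of \<alpha>] by auto
  also have "\<bar>(p - y) \<bullet> h\<bar> \<le> norm (p - y) * norm h"
    by (rule Cauchy_Schwarz_ineq2)
  also have "\<dots> \<le> 3 * \<epsilon> * norm h"
    using D(5) by (intro mult_right_mono) (auto simp: p_def)
  finally show "loss_sign \<alpha> * (\<integral>s. s \<bullet> h \<partial>q) \<le> loss_sign \<alpha> * (y \<bullet> h) + 3 * \<epsilon> * norm h"
    by simp
qed

text \<open>
  As the adversary is oblivious and the projection is deterministic, the point \<open>y\<close> and the number
  \<open>n\<close> of oracle calls are deterministic; only the list of plays is random, with law \<open>p\<close>. The number
  \<open>j\<close> counts the hyperplane steps so far. Both the regret and \<open>j\<close> are controlled by the squared
  distances from \<open>y\<close> to the points of \<open>\<alpha> \<K>\<close>.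
\<close>

definition run_invariant ::
    "real ^ 'n \<Rightarrow> (nat \<Rightarrow> real ^ 'n) \<Rightarrow> real \<Rightarrow> real \<Rightarrow> real \<Rightarrow> nat \<Rightarrow>
     real ^ 'n \<Rightarrow> nat \<Rightarrow> nat \<Rightarrow> (real ^ 'n) list pmf \<Rightarrow> bool" where
  "run_invariant s1 f F \<eta> \<epsilon> t y n j p \<longleftrightarrow>
     full_information \<alpha> R \<O> qp N s1 f \<eta> \<epsilon> t = spmf_of_pmf (map_pmf (\<lambda>ss. (y, ss, n)) p) \<and>
     finite (set_pmf p) \<and>
     (\<forall>ss\<in>set_pmf p. length ss = Suc t) \<and>
     real n \<le> (real t + real j) * calls_per_step \<epsilon> \<and>
     (\<forall>x\<in>\<K>. norm (y - \<alpha> *\<^sub>R x) \<le> 2 * (\<alpha> * R)) \<and>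
     (norm (y - \<alpha> *\<^sub>R s1))\<^sup>2 + real j * \<epsilon>\<^sup>2 \<le> real t * (4 * \<eta> * \<alpha> * R * F + \<eta>\<^sup>2 * F\<^sup>2) \<and>
     (\<forall>h\<in>nonneg_orthant.
        loss_sign \<alpha> * (\<integral>ss. ss ! t \<bullet> h \<partial>p) \<le> loss_sign \<alpha> * (y \<bullet> h) + 3 * \<epsilon> * norm h) \<and>
     (\<forall>x\<in>\<K>. 2 * \<eta> * loss_sign \<alpha> * ((\<integral>ss. (\<Sum>i<t. ss ! i \<bullet> f i) \<partial>p) - \<alpha> * (\<Sum>i<t. x \<bullet> f i)) +
        (norm (y - \<alpha> *\<^sub>R x))\<^sup>2
        \<le> (norm (\<alpha> *\<^sub>R s1 - \<alpha> *\<^sub>R x))\<^sup>2 + real t * (\<eta>\<^sup>2 * F\<^sup>2 + 6 * \<eta> * \<epsilon> * F))"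

lemma run_invariant_0:
  assumes s1: "s1 \<in> \<K>" and \<epsilon>: "0 < \<epsilon>"
  shows "run_invariant s1 f F \<eta> \<epsilon> 0 (\<alpha> *\<^sub>R s1) 0 0 (return_pmf [s1])"
proof -
  have "norm (\<alpha> *\<^sub>R s1 - \<alpha> *\<^sub>R x) \<le> 2 * (\<alpha> * R)" if "x \<in> \<K>" for x
  proof -
    have "norm (\<alpha> *\<^sub>R s1 - \<alpha> *\<^sub>R x) \<le> \<alpha> * norm s1 + \<alpha> * norm x"
      using norm_triangle_ineq4[of "\<alpha> *\<^sub>R s1" "\<alpha> *\<^sub>R x"] \<alpha>_pos by simp
    moreover have "\<alpha> * norm s1 \<le> \<alpha> * R" "\<alpha> * norm x \<le> \<alpha> * R"
      using K_norm s1 that \<alpha>_pos by auto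
    ultimately show ?thesis by linarith
  qed
  moreover have "loss_sign \<alpha> * (s1 \<bullet> h) \<le> loss_sign \<alpha> * (\<alpha> *\<^sub>R s1 \<bullet> h) + 3 * \<epsilon> * norm h"
    if h: "h \<in> nonneg_orthant" for h
  proof -
    have "0 \<le> s1 \<bullet> h" using s1 K_nonneg h by (auto intro: nonneg_orthant_inner)
    \<comment> \<open>The first play is \<open>s1\<close> itself while the iterate is
      \<open>\<alpha> *\<^sub>R s1\<close>; the sign of \<alpha> - 1 makes the play the better of
      the two.\<close>
    moreover have "0 \<le> loss_sign \<alpha> * (\<alpha> - 1)" by (simp add: loss_sign_def)
    ultimately have "0 \<le> loss_sign \<alpha> * (\<alpha> - 1) * (s1 \<bullet> h)" by (rule mult_nonneg_nonneg[rotated])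
    moreover have "0 \<le> 3 * \<epsilon> * norm h" using \<epsilon> by simp
    ultimately show ?thesis by (simp add: algebra_simps)
  qed
  ultimately show ?thesis
    unfolding run_invariant_def by simp
qed

text \<open>The play with index t was sampled one step earlier, so its cost is bounded by the
  invariant at t, and the point sampled now supplies the corresponding bound for index
  \<open>Suc t\<close>. The gradient step turns that cost into a change of squared distance, which
  telescopes.\<close>

lemma run_invariant_Suc:
  assumes inv: "run_invariant s1 f F \<eta> \<epsilon> t y n j p"
    and s1: "s1 \<in> \<K>" and \<eta>: "0 < \<eta>" and \<epsilon>: "0 < \<epsilon>"
    and f: "f t \<in> nonneg_orthant" "norm (f t) \<le> F"
  obtains y' n' j' p' where "run_invariant s1 f F \<eta> \<epsilon> (Suc t) y' n' j' p'"
proof -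
  define \<sigma> where "\<sigma> = loss_sign \<alpha>"
  have \<sigma>: "\<sigma> = 1 \<or> \<sigma> = - 1" using loss_sign_cases by (simp add: \<sigma>_def)
  have F: "0 \<le> F" using f(2) norm_ge_zero order_trans by blast
  have run: "full_information \<alpha> R \<O> qp N s1 f \<eta> \<epsilon> t = spmf_of_pmf (map_pmf (\<lambda>ss. (y, ss, n)) p)"
    and fin: "finite (set_pmf p)" and len: "\<And>ss. ss \<in> set_pmf p \<Longrightarrow> length ss = Suc t"
    and calls: "real n \<le> (real t + real j) * calls_per_step \<epsilon>"
    and near: "\<And>x. x \<in> \<K> \<Longrightarrow> norm (y - \<alpha> *\<^sub>R x) \<le> 2 * (\<alpha> * R)"
    and steps: "(norm (y - \<alpha> *\<^sub>R s1))\<^sup>2 + real j * \<epsilon>\<^sup>2 \<le> real t * (4 * \<eta> * \<alpha> * R * F + \<eta>\<^sup>2 * F\<^sup>2)"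
    and last: "\<And>h. h \<in> nonneg_orthant \<Longrightarrow>
      \<sigma> * (\<integral>ss. ss ! t \<bullet> h \<partial>p) \<le> \<sigma> * (y \<bullet> h) + 3 * \<epsilon> * norm h"
    and regret: "\<And>x. x \<in> \<K> \<Longrightarrow>
      2 * \<eta> * \<sigma> * ((\<integral>ss. (\<Sum>i<t. ss ! i \<bullet> f i) \<partial>p) - \<alpha> * (\<Sum>i<t. x \<bullet> f i)) +
      (norm (y - \<alpha> *\<^sub>R x))\<^sup>2
      \<le> (norm (\<alpha> *\<^sub>R s1 - \<alpha> *\<^sub>R x))\<^sup>2 + real t * (\<eta>\<^sup>2 * F\<^sup>2 + 6 * \<eta> * \<epsilon> * F)"
    using inv by (auto simp: run_invariant_def \<sigma>_def)
  define y1 where "y1 = y - (\<eta> * \<sigma>) *\<^sub>R f t"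
  have y1: "(if \<alpha> \<ge> 1 then y - \<eta> *\<^sub>R f t else y + \<eta> *\<^sub>R f t) = y1"
    by (auto simp: y1_def \<sigma>_def loss_sign_def)
  obtain y' a ps m m' k where proj: "projection \<alpha> R \<O> qp N \<epsilon> y1 = Some (y', a, ps, m)"
    and dec: "sep_or_decomp \<alpha> R \<O> qp N \<epsilon> y' = (Decomposition a ps, m')"
    and close: "\<And>x. x \<in> \<K> \<Longrightarrow> (norm (y' - \<alpha> *\<^sub>R x))\<^sup>2 + real k * \<epsilon>\<^sup>2 \<le> (norm (y1 - \<alpha> *\<^sub>R x))\<^sup>2"
    and near': "\<And>x. x \<in> \<K> \<Longrightarrow> norm (y' - \<alpha> *\<^sub>R x) \<le> 2 * (\<alpha> * R)"
    and m: "real m \<le> (real k + 1) * calls_per_step \<epsilon>"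
    using projection_terminates[OF \<epsilon>, of y1] by metis
  define q where "q = pmf_of_list (zip (map snd ps) a)"
  note q = decomposition_play[OF \<epsilon> dec, folded q_def \<sigma>_def]
  \<comment> \<open>The law q of the new play comes from the deterministic point \<open>y'\<close>,
    so it does not depend on the earlier plays and the joint law is a product.\<close>
  define p' where "p' = map_pmf (\<lambda>(ss, s). ss @ [s]) (pair_pmf p q)"
  have int_old: "(\<integral>ss. \<phi> ss \<partial>p') = (\<integral>ss. \<phi> ss \<partial>p)"
    if "\<And>ss s. ss \<in> set_pmf p \<Longrightarrow> \<phi> (ss @ [s]) = \<phi> ss" for \<phi> :: "(real ^ 'n) list \<Rightarrow> real"
  proof -
    have "(\<integral>ss. \<phi> ss \<partial>p') = (\<integral>z. \<phi> (fst z @ [snd z]) \<partial>pair_pmf p q)"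
      by (simp add: p'_def case_prod_unfold)
    also have "\<dots> = (\<integral>z. \<phi> (fst z) \<partial>pair_pmf p q)"
      by (rule integral_cong_AE) (auto simp: AE_measure_pmf_iff that)
    also have "\<dots> = (\<integral>ss. \<phi> ss \<partial>p)" by simp
    finally show ?thesis .
  qed
  have int_new: "(\<integral>ss. ss ! Suc t \<bullet> h \<partial>p') = (\<integral>s. s \<bullet> h \<partial>q)" for h
  proof -
    have "(\<integral>ss. ss ! Suc t \<bullet> h \<partial>p') = (\<integral>z. (fst z @ [snd z]) ! Suc t \<bullet> h \<partial>pair_pmf p q)"
      by (simp add: p'_def case_prod_unfold)
    also have "\<dots> = (\<integral>z. snd z \<bullet> h \<partial>pair_pmf p q)"
      by (rule integral_cong_AE) (auto simp: AE_measure_pmf_iff len nth_append)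
    also have "\<dots> = (\<integral>s. s \<bullet> h \<partial>map_pmf snd (pair_pmf p q))"
      by (rule integral_map_pmf[symmetric])
    also have "\<dots> = (\<integral>s. s \<bullet> h \<partial>q)" by (simp only: map_snd_pair_pmf)
    finally show ?thesis .
  qed
  have y1_norm: "(norm (y1 - \<alpha> *\<^sub>R x))\<^sup>2 \<le>
      (norm (y - \<alpha> *\<^sub>R x))\<^sup>2 - 2 * \<eta> * \<sigma> * ((y - \<alpha> *\<^sub>R x) \<bullet> f t) + \<eta>\<^sup>2 * F\<^sup>2" for x
  proof -
    have "y1 - \<alpha> *\<^sub>R x = (y - \<alpha> *\<^sub>R x) - (\<eta> * \<sigma>) *\<^sub>R f t"
      by (simp add: y1_def)
    then have "(norm (y1 - \<alpha> *\<^sub>R x))\<^sup>2 = (norm (y - \<alpha> *\<^sub>R x))\<^sup>2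
        - 2 * (\<eta> * \<sigma>) * ((y - \<alpha> *\<^sub>R x) \<bullet> f t) + (\<eta> * \<sigma>)\<^sup>2 * (norm (f t))\<^sup>2"
      by (simp only: power2_norm_diff_scaleR)
    also have "(\<eta> * \<sigma>)\<^sup>2 = \<eta>\<^sup>2"
      using \<sigma> by (auto simp: power_mult_distrib)
    also have "\<eta>\<^sup>2 * (norm (f t))\<^sup>2 \<le> \<eta>\<^sup>2 * F\<^sup>2"
      using f(2) by (intro mult_left_mono power_mono) simp_all
    finally show ?thesis by (simp add: mult.assoc)
  qed
  \<comment> \<open>The potential estimate: Cauchy-Schwarz with distance at most 2 \<alpha> R bounds
    the linear term of the gradient step by \<open>4 * \<eta> * \<alpha> * R * F\<close>, and the k
    hyperplane steps pay it back.\<close>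
  have steps': "(norm (y' - \<alpha> *\<^sub>R s1))\<^sup>2 + real (j + k) * \<epsilon>\<^sup>2
      \<le> real (Suc t) * (4 * \<eta> * \<alpha> * R * F + \<eta>\<^sup>2 * F\<^sup>2)"
  proof -
    have "- \<sigma> * ((y - \<alpha> *\<^sub>R s1) \<bullet> f t) \<le> \<bar>(y - \<alpha> *\<^sub>R s1) \<bullet> f t\<bar>"
      using \<sigma> by auto
    also have "\<dots> \<le> norm (y - \<alpha> *\<^sub>R s1) * norm (f t)" by (rule Cauchy_Schwarz_ineq2)
    also have "\<dots> \<le> 2 * (\<alpha> * R) * F"
      using near[OF s1] f(2) \<alpha>_pos R_pos by (intro mult_mono) auto
    finally have "2 * \<eta> * (- \<sigma> * ((y - \<alpha> *\<^sub>R s1) \<bullet> f t)) \<le> 2 * \<eta> * (2 * (\<alpha> * R) * F)"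
      using \<eta> by (intro mult_left_mono) auto
    then show ?thesis
      using close[OF s1] y1_norm[of s1] steps by (simp add: algebra_simps)
  qed
  have regret': "2 * \<eta> * \<sigma> * ((\<integral>ss. (\<Sum>i<Suc t. ss ! i \<bullet> f i) \<partial>p') - \<alpha> * (\<Sum>i<Suc t. x \<bullet> f i)) +
      (norm (y' - \<alpha> *\<^sub>R x))\<^sup>2
      \<le> (norm (\<alpha> *\<^sub>R s1 - \<alpha> *\<^sub>R x))\<^sup>2 + real (Suc t) * (\<eta>\<^sup>2 * F\<^sup>2 + 6 * \<eta> * \<epsilon> * F)"
    if x: "x \<in> \<K>" for x
  proof -
    define G where "G = (\<integral>ss. (\<Sum>i<t. ss ! i \<bullet> f i) \<partial>p)"
    define L where "L = (\<integral>ss. ss ! t \<bullet> f t \<partial>p)"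
    have "(\<integral>ss. (\<Sum>i<Suc t. ss ! i \<bullet> f i) \<partial>p') = (\<integral>ss. (\<Sum>i<Suc t. ss ! i \<bullet> f i) \<partial>p)"
      by (rule int_old) (auto intro!: sum.cong simp: len nth_append)
    also have "\<dots> = G + L"
      unfolding G_def L_def
      by (simp add: Bochner_Integration.integral_add integrable_measure_pmf_finite[OF fin])
    finally have GL: "(\<integral>ss. (\<Sum>i<Suc t. ss ! i \<bullet> f i) \<partial>p') = G + L" .
    have "\<sigma> * L \<le> \<sigma> * (y \<bullet> f t) + 3 * \<epsilon> * F"
    proof -
      have "3 * \<epsilon> * norm (f t) \<le> 3 * \<epsilon> * F" using f(2) \<epsilon> by simp
      then show ?thesis using last[OF f(1)] by (simp add: L_def)
    qed
    then have "2 * \<eta> * (\<sigma> * L) \<le> 2 * \<eta> * (\<sigma> * (y \<bullet> f t) + 3 * \<epsilon> * F)"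
      using \<eta> by (intro mult_left_mono) auto
    moreover have "(norm (y' - \<alpha> *\<^sub>R x))\<^sup>2 \<le>
        (norm (y - \<alpha> *\<^sub>R x))\<^sup>2 - 2 * \<eta> * \<sigma> * ((y - \<alpha> *\<^sub>R x) \<bullet> f t) + \<eta>\<^sup>2 * F\<^sup>2"
    proof -
      \<comment> \<open>For the regret, the decrease gained by the hyperplane steps is
        discarded.\<close>
      have "0 \<le> real k * \<epsilon>\<^sup>2" by simp
      then show ?thesis using close[OF x] y1_norm[of x] by linarith
    qed
    moreover note regret[OF x, folded G_def]
    ultimately show ?thesis
      unfolding GL by (simp add: inner_diff_left algebra_simps)
  qed
  have "full_information \<alpha> R \<O> qp N s1 f \<eta> \<epsilon> (Suc t) =
      bind_pmf p (\<lambda>ss. spmf_of_pmf (map_pmf (\<lambda>s. (y', ss @ [s], n + m)) q))"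
    by (simp add: run y1 proj q_def bind_map_pmf)
  also have "\<dots> = spmf_of_pmf (bind_pmf p (\<lambda>ss. map_pmf (\<lambda>s. (y', ss @ [s], n + m)) q))"
    by (simp add: spmf_of_pmf_bind)
  also have "bind_pmf p (\<lambda>ss. map_pmf (\<lambda>s. (y', ss @ [s], n + m)) q) =
      map_pmf (\<lambda>ss. (y', ss, n + m)) p'"
    unfolding p'_def pair_pmf_def by (simp add: map_pmf_def bind_assoc_pmf bind_return_pmf)
  finally have "full_information \<alpha> R \<O> qp N s1 f \<eta> \<epsilon> (Suc t) =
      spmf_of_pmf (map_pmf (\<lambda>ss. (y', ss, n + m)) p')" .
  moreover have "finite (set_pmf p')"
    using fin q(1) by (simp add: p'_def)
  moreover have "real (n + m) \<le> (real (Suc t) + real (j + k)) * calls_per_step \<epsilon>"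
    using calls m by (simp add: algebra_simps)
  ultimately have "run_invariant s1 f F \<eta> \<epsilon> (Suc t) y' (n + m) (j + k) p'"
    unfolding run_invariant_def int_new
    using near' steps' regret' q(2) by (auto simp: p'_def len \<sigma>_def[symmetric] simp del: full_information.simps)
  then show thesis by (rule that)
qed

lemma run_invariant_exists:
  assumes s1: "s1 \<in> \<K>" and "0 < \<eta>" and "0 < \<epsilon>"
    and f: "\<And>i. i < t \<Longrightarrow> f i \<in> nonneg_orthant \<and> norm (f i) \<le> F"
  shows "\<exists>y n j p. run_invariant s1 f F \<eta> \<epsilon> t y n j p"
  using f
proof (induction t)
  case 0
  then show ?case using run_invariant_0[OF s1 assms(3)] by blast
next
  case (Suc t)
  have "\<exists>y n j p. run_invariant s1 f F \<eta> \<epsilon> t y n j p"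
    by (rule Suc.IH) (simp add: Suc.prems)
  then obtain y n j p where inv: "run_invariant s1 f F \<eta> \<epsilon> t y n j p" by (elim exE)
  have "f t \<in> nonneg_orthant" "norm (f t) \<le> F" using Suc.prems[of t] by simp_all
  from run_invariant_Suc[OF inv s1 assms(2,3) this] show ?case by metis
qed

end

section \<open>Regret and oracle-call bounds, in general and for tuned parameters\<close>

lemma average_calls_le_mono:
  "average_calls_le T run B \<Longrightarrow> B \<le> B' \<Longrightarrow> average_calls_le T run B'"
  by (force simp: average_calls_le_def)

context online_problem
begin

lemma full_information_bounds:
  assumes s1: "s1 \<in> \<K>" and \<eta>: "0 < \<eta>" and \<epsilon>: "0 < \<epsilon>" and T: "0 < T" and F: "0 < F"
    and f: "\<forall>t<T. f t \<in> nonneg_orthant \<and> norm (f t) \<le> F"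
  defines "run \<equiv> full_information \<alpha> R \<O> qp N s1 f \<eta> \<epsilon> T"
  shows "lossless_spmf run"
    and "expected_regret \<alpha> \<K> T f run \<le> \<alpha>\<^sup>2 * R\<^sup>2 / (real T * \<eta>) + \<eta> * F\<^sup>2 / 2 + 3 * F * \<epsilon>"
    and "average_calls_le T run
      (16 * c' * ((1 + (\<eta> * \<alpha> * R * F + \<eta>\<^sup>2 * F\<^sup>2) / \<epsilon>\<^sup>2)
        * (real CARD('n))\<^sup>2 * max 1 (ln ((\<alpha> + 1) * R / \<epsilon>))))"
proof -
  have "\<exists>y n j p. run_invariant s1 f F \<eta> \<epsilon> T y n j p"
    by (rule run_invariant_exists[OF s1 \<eta> \<epsilon>]) (use f in blast)
  then obtain y n j p where inv: "run_invariant s1 f F \<eta> \<epsilon> T y n j p" by (elim exE)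
  have run: "run = spmf_of_pmf (map_pmf (\<lambda>ss. (y, ss, n)) p)"
    and fin: "finite (set_pmf p)"
    and calls: "real n \<le> (real T + real j) * calls_per_step \<epsilon>"
    and steps: "(norm (y - \<alpha> *\<^sub>R s1))\<^sup>2 + real j * \<epsilon>\<^sup>2 \<le> real T * (4 * \<eta> * \<alpha> * R * F + \<eta>\<^sup>2 * F\<^sup>2)"
    and regret: "\<And>x. x \<in> \<K> \<Longrightarrow>
      2 * \<eta> * loss_sign \<alpha> * ((\<integral>ss. (\<Sum>i<T. ss ! i \<bullet> f i) \<partial>p) - \<alpha> * (\<Sum>i<T. x \<bullet> f i)) +
      (norm (y - \<alpha> *\<^sub>R x))\<^sup>2
      \<le> (norm (\<alpha> *\<^sub>R s1 - \<alpha> *\<^sub>R x))\<^sup>2 + real T * (\<eta>\<^sup>2 * F\<^sup>2 + 6 * \<eta> * \<epsilon> * F)"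
    using inv by (auto simp: run_invariant_def run_def)
  show "lossless_spmf run" by (simp add: run)
  define X where "X = \<eta> * \<alpha> * R * F + \<eta>\<^sup>2 * F\<^sup>2"
  define M where "M = c' * ((real CARD('n))\<^sup>2 * max 1 (ln ((\<alpha> + 1) * R / \<epsilon>)))"
  have M: "0 \<le> M" using c'_pos by (simp add: M_def)
  have X: "0 \<le> X" using \<eta> \<alpha>_pos R_pos F by (simp add: X_def)
  show "average_calls_le T run
      (16 * c' * ((1 + (\<eta> * \<alpha> * R * F + \<eta>\<^sup>2 * F\<^sup>2) / \<epsilon>\<^sup>2)
        * (real CARD('n))\<^sup>2 * max 1 (ln ((\<alpha> + 1) * R / \<epsilon>))))"
  proof -
    have "4 * \<eta> * \<alpha> * R * F + \<eta>\<^sup>2 * F\<^sup>2 \<le> 4 * X" by (simp add: X_def)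
    then have "real T * (4 * \<eta> * \<alpha> * R * F + \<eta>\<^sup>2 * F\<^sup>2) \<le> real T * (4 * X)"
      by (intro mult_left_mono) auto
    moreover have "0 \<le> (norm (y - \<alpha> *\<^sub>R s1))\<^sup>2" by simp
    ultimately have "real j * \<epsilon>\<^sup>2 \<le> real T * (4 * X)" using steps by linarith
    then have j: "real j \<le> real T * (4 * X / \<epsilon>\<^sup>2)" using \<epsilon> by (simp add: field_simps)
    have "real T \<le> real T * 4" by simp
    with j have "real T + real j \<le> real T * (4 * (1 + X / \<epsilon>\<^sup>2))" by (simp add: algebra_simps)
    moreover have "0 \<le> calls_per_step \<epsilon>" using c'_pos by (simp add: calls_per_step_def)
    ultimately have "(real T + real j) * calls_per_step \<epsilon> \<le>
        real T * (4 * (1 + X / \<epsilon>\<^sup>2)) * calls_per_step \<epsilon>"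
      by (rule mult_right_mono)
    with calls have "real n \<le> real T * (4 * (1 + X / \<epsilon>\<^sup>2)) * calls_per_step \<epsilon>" by linarith
    then have "real n / real T \<le> 4 * (1 + X / \<epsilon>\<^sup>2) * calls_per_step \<epsilon>"
      using T by (simp add: field_simps)
    \<comment> \<open>A factor 4 from the amortised step count times 12 / 5 from the logarithm,
      rounded up to 16 below.\<close>
    also have "\<dots> = 48 / 5 * ((1 + X / \<epsilon>\<^sup>2) * M)"
      by (simp add: calls_per_step_def M_def)
    also have "\<dots> \<le> 16 * ((1 + X / \<epsilon>\<^sup>2) * M)"
      using X M by (intro mult_right_mono mult_nonneg_nonneg) auto
    also have "\<dots> = 16 * c' * ((1 + X / \<epsilon>\<^sup>2) * (real CARD('n))\<^sup>2 * max 1 (ln ((\<alpha> + 1) * R / \<epsilon>)))"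
      by (simp add: M_def mult_ac)
    finally show ?thesis
      by (simp add: average_calls_le_def run oracle_calls_def X_def)
  qed
  define G where "G = (\<integral>ss. (\<Sum>i<T. ss ! i \<bullet> f i) \<partial>p)"
  define B where "B = \<alpha>\<^sup>2 * R\<^sup>2 / (real T * \<eta>) + \<eta> * F\<^sup>2 / 2 + 3 * F * \<epsilon>"
  have bound: "loss_sign \<alpha> * (G / real T - \<alpha> * (1 / real T * (\<Sum>i<T. x \<bullet> f i))) \<le> B"
    if x: "x \<in> \<K>" for x
  proof -
    have sq: "(norm z)\<^sup>2 \<le> R\<^sup>2" if "z \<in> \<K>" for z
      using K_norm[OF that] by (simp add: power_mono)
    have "(norm (s1 - x))\<^sup>2 \<le> (norm s1)\<^sup>2 + (norm x)\<^sup>2"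
      using s1 x K_nonneg by (intro norm_diff_nonneg_orthant) auto
    also have "\<dots> \<le> 2 * R\<^sup>2" using sq[OF s1] sq[OF x] by simp
    finally have "\<alpha>\<^sup>2 * (norm (s1 - x))\<^sup>2 \<le> \<alpha>\<^sup>2 * (2 * R\<^sup>2)" by (intro mult_left_mono) auto
    moreover have "(norm (\<alpha> *\<^sub>R s1 - \<alpha> *\<^sub>R x))\<^sup>2 = \<alpha>\<^sup>2 * (norm (s1 - x))\<^sup>2"
      by (simp add: power_mult_distrib flip: scaleR_diff_right)
    moreover have "0 \<le> (norm (y - \<alpha> *\<^sub>R x))\<^sup>2" by simp
    ultimately have "2 * \<eta> * loss_sign \<alpha> * (G - \<alpha> * (\<Sum>i<T. x \<bullet> f i)) \<le>
        \<alpha>\<^sup>2 * (2 * R\<^sup>2) + real T * (\<eta>\<^sup>2 * F\<^sup>2 + 6 * \<eta> * \<epsilon> * F)"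
      using regret[OF x, folded G_def] by linarith
    also have "\<dots> = 2 * \<eta> * real T * B"
      using T \<eta> by (simp add: B_def field_simps power2_eq_square)
    finally have "2 * \<eta> * (loss_sign \<alpha> * (G - \<alpha> * (\<Sum>i<T. x \<bullet> f i))) \<le> 2 * \<eta> * (real T * B)"
      by (simp add: mult_ac)
    then have "loss_sign \<alpha> * (G - \<alpha> * (\<Sum>i<T. x \<bullet> f i)) \<le> real T * B"
      using \<eta> by simp
    then show ?thesis using T by (simp add: field_simps)
  qed
  have int: "integrable p (\<lambda>ss. \<phi> ss)" for \<phi> :: "(real ^ 'n) list \<Rightarrow> real"
    by (rule integrable_measure_pmf_finite[OF fin])
  have E: "expected_regret \<alpha> \<K> T f run =
      (\<integral>ss. alpha_regret \<alpha> \<K> T (\<lambda>t. ss ! t) f \<partial>p)"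
    by (simp add: expected_regret_def run plays_def[abs_def])
  \<comment> \<open>The comparator does not depend on the plays, so only the term linear in the
    plays is averaged. The bound, valid for each x, is then rearranged to pass to the infimum or
    supremum.\<close>
  have "expected_regret \<alpha> \<K> T f run \<le> B"
  proof (cases "1 \<le> \<alpha>")
    case True
    define I where "I = (INF x\<in>\<K>. 1 / real T * (\<Sum>t<T. x \<bullet> f t))"
    have "(G / real T - B) / \<alpha> \<le> I"
      unfolding I_def
    proof (rule cINF_greatest[OF K_nonempty])
      fix x assume "x \<in> \<K>"
      from bound[OF this] show "(G / real T - B) / \<alpha> \<le> 1 / real T * (\<Sum>t<T. x \<bullet> f t)"
        using True by (simp add: loss_sign_def field_simps)
    qed
    moreover have "expected_regret \<alpha> \<K> T f run = G / real T - \<alpha> * I"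
      unfolding E alpha_regret_def I_def[symmetric] G_def using True by (simp add: int)
    ultimately show ?thesis using \<alpha>_pos by (simp add: field_simps)
  next
    case False
    define S where "S = (SUP x\<in>\<K>. 1 / real T * (\<Sum>t<T. x \<bullet> f t))"
    have "S \<le> (G / real T + B) / \<alpha>"
      unfolding S_def
    proof (rule cSUP_least[OF K_nonempty])
      fix x assume "x \<in> \<K>"
      from bound[OF this] show "1 / real T * (\<Sum>t<T. x \<bullet> f t) \<le> (G / real T + B) / \<alpha>"
        using False \<alpha>_pos by (simp add: loss_sign_def field_simps)
    qed
    moreover have "expected_regret \<alpha> \<K> T f run = \<alpha> * S - G / real T"
      unfolding E alpha_regret_def S_def[symmetric] G_def using False by (simp add: int)
    ultimately show ?thesis using \<alpha>_pos by (simp add: field_simps)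
  qed
  then show "expected_regret \<alpha> \<K> T f run \<le> \<alpha>\<^sup>2 * R\<^sup>2 / (real T * \<eta>) + \<eta> * F\<^sup>2 / 2 + 3 * F * \<epsilon>"
    by (simp add: B_def)
qed

text \<open>
  Both parameter choices of the theorem have the form \<open>\<eta> = \<alpha> R h / F\<close>, \<open>\<epsilon> = \<alpha> R u\<close> with
  \<open>T h u = 1\<close>.
\<close>

lemma full_information_tuned:
  fixes u h :: real
  assumes s1: "s1 \<in> \<K>" and T: "0 < T" and F: "0 < F"
    and f: "\<forall>t<T. f t \<in> nonneg_orthant \<and> norm (f t) \<le> F"
    and u: "0 < u" and h: "0 < h" "h \<le> u" and Thu: "real T * h * u = 1" and h1: "h \<le> 1"
    and K: "1 \<le> K" "h / u\<^sup>2 \<le> K"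
  defines "run \<equiv> full_information \<alpha> R \<O> qp N s1 f (\<alpha> * R * h / F) (\<alpha> * R * u) T"
  shows "expected_regret \<alpha> \<K> T f run \<le> 5 * (\<alpha> * R * F * u)"
    and "average_calls_le T run
      (48 * c' * (K * (real CARD('n))\<^sup>2 * max 1 (ln ((\<alpha> + 1) / \<alpha> * real T))))"
proof -
  define \<eta> where "\<eta> = \<alpha> * R * h / F"
  define \<epsilon> where "\<epsilon> = \<alpha> * R * u"
  have aR: "0 < \<alpha> * R" using \<alpha>_pos R_pos by simp
  have pos: "0 < \<eta>" "0 < \<epsilon>" using aR u h F by (auto simp: \<eta>_def \<epsilon>_def)
  have run: "run = full_information \<alpha> R \<O> qp N s1 f \<eta> \<epsilon> T"
    by (simp only: run_def \<eta>_def \<epsilon>_def)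
  note B = full_information_bounds[OF s1 pos T F f, folded run]
  have \<eta>F: "\<eta> * F = \<alpha> * R * h" using F by (simp add: \<eta>_def)
  \<comment> \<open>The three terms of the regret bound are 1, at most 1 / 2, and 3 times
    \<open>\<alpha> * R * F * u\<close>.\<close>
  have sum_le: "a + b + e \<le> 5 * k" if "a = k" "b \<le> k / 2" "e = 3 * k" "0 \<le> k" for a b e k :: real
    using that by linarith
  have "\<alpha>\<^sup>2 * R\<^sup>2 / (real T * \<eta>) = \<alpha> * R * F * u"
  proof -
    have "real T * \<eta> * (\<alpha> * R * F * u) = (\<alpha> * R) * (\<eta> * F) * real T * u" by (simp add: mult_ac)
    also have "\<dots> = \<alpha>\<^sup>2 * R\<^sup>2 * (real T * h * u)"
      unfolding \<eta>F by (simp add: power2_eq_square mult_ac)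
    finally have "real T * \<eta> * (\<alpha> * R * F * u) = \<alpha>\<^sup>2 * R\<^sup>2" by (simp only: Thu mult_1_right)
    moreover have "real T * \<eta> \<noteq> 0" using T pos by simp
    ultimately show ?thesis by (metis nonzero_mult_div_cancel_left)
  qed
  moreover have "\<eta> * F\<^sup>2 / 2 \<le> \<alpha> * R * F * u / 2"
  proof -
    have "\<eta> * F\<^sup>2 = \<alpha> * R * F * h" using \<eta>F by (simp add: power2_eq_square mult_ac)
    also have "\<dots> \<le> \<alpha> * R * F * u" using h(2) aR F by (intro mult_left_mono) auto
    finally show ?thesis by simp
  qed
  moreover have "3 * F * \<epsilon> = 3 * (\<alpha> * R * F * u)" by (simp add: \<epsilon>_def)
  moreover have "0 \<le> \<alpha> * R * F * u" using aR F u by simp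
  ultimately have "\<alpha>\<^sup>2 * R\<^sup>2 / (real T * \<eta>) + \<eta> * F\<^sup>2 / 2 + 3 * F * \<epsilon> \<le> 5 * (\<alpha> * R * F * u)"
    by (rule sum_le)
  with B(2) show "expected_regret \<alpha> \<K> T f run \<le> 5 * (\<alpha> * R * F * u)"
    by (rule order_trans)
  have "(\<eta> * \<alpha> * R * F + \<eta>\<^sup>2 * F\<^sup>2) / \<epsilon>\<^sup>2 = h / u\<^sup>2 + h\<^sup>2 / u\<^sup>2"
  proof -
    have "\<eta> * \<alpha> * R * F + \<eta>\<^sup>2 * F\<^sup>2 = (\<alpha> * R) * (\<eta> * F) + (\<eta> * F)\<^sup>2"
      by (simp add: power_mult_distrib mult_ac)
    also have "\<dots> = (\<alpha> * R)\<^sup>2 * (h + h\<^sup>2)"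
      unfolding \<eta>F by (simp add: power2_eq_square algebra_simps)
    finally show ?thesis
      using \<alpha>_pos R_pos
      by (simp add: \<epsilon>_def power_mult_distrib[of "\<alpha> * R" u] add_divide_distrib)
  qed
  also have "\<dots> \<le> K + K"
  proof -
    have "h\<^sup>2 \<le> h" using h h1 by (simp add: power2_eq_square mult_left_le)
    then have "h\<^sup>2 / u\<^sup>2 \<le> h / u\<^sup>2" by (simp add: divide_right_mono)
    then show ?thesis using K(2) by linarith
  qed
  finally have "1 + (\<eta> * \<alpha> * R * F + \<eta>\<^sup>2 * F\<^sup>2) / \<epsilon>\<^sup>2 \<le> 3 * K" using K(1) by linarith
  moreover have "max 1 (ln ((\<alpha> + 1) * R / \<epsilon>)) \<le> max 1 (ln ((\<alpha> + 1) / \<alpha> * real T))"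
  proof -
    \<comment> \<open>Since T h u = 1 and h is at most 1, the ratio R / \<epsilon> in the logarithm
      is at most T / \<alpha>.\<close>
    have "1 / u = real T * h" using Thu u by (simp add: field_simps)
    also have "\<dots> \<le> real T" using h1 by (simp add: mult_left_le)
    finally have "1 / u \<le> real T" .
    then have "(\<alpha> + 1) / \<alpha> * (1 / u) \<le> (\<alpha> + 1) / \<alpha> * real T"
      using \<alpha>_pos by (intro mult_left_mono) auto
    moreover have "(\<alpha> + 1) * R / \<epsilon> = (\<alpha> + 1) / \<alpha> * (1 / u)"
      using R_pos by (simp add: \<epsilon>_def)
    moreover have "0 < (\<alpha> + 1) / \<alpha> * (1 / u)" using \<alpha>_pos u by simp
    ultimately have "ln ((\<alpha> + 1) * R / \<epsilon>) \<le> ln ((\<alpha> + 1) / \<alpha> * real T)"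
      by (metis ln_mono)
    then show ?thesis by simp
  qed
  ultimately have "(1 + (\<eta> * \<alpha> * R * F + \<eta>\<^sup>2 * F\<^sup>2) / \<epsilon>\<^sup>2) * (real CARD('n))\<^sup>2 *
      max 1 (ln ((\<alpha> + 1) * R / \<epsilon>)) \<le>
      3 * K * (real CARD('n))\<^sup>2 * max 1 (ln ((\<alpha> + 1) / \<alpha> * real T))"
    using K(1) by (intro mult_mono mult_nonneg_nonneg) auto
  then have "16 * c' * ((1 + (\<eta> * \<alpha> * R * F + \<eta>\<^sup>2 * F\<^sup>2) / \<epsilon>\<^sup>2) * (real CARD('n))\<^sup>2 *
      max 1 (ln ((\<alpha> + 1) * R / \<epsilon>))) \<le>
      16 * c' * (3 * K * (real CARD('n))\<^sup>2 * max 1 (ln ((\<alpha> + 1) / \<alpha> * real T)))"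
    using c'_pos by (intro mult_left_mono) auto
  then show "average_calls_le T run
      (48 * c' * (K * (real CARD('n))\<^sup>2 * max 1 (ln ((\<alpha> + 1) / \<alpha> * real T))))"
    using B(3) by (elim average_calls_le_mono) (simp add: mult_ac)
qed

end

theorem theorem1:
  fixes \<K> \<F> :: "(real ^ 'n) set"
    and \<O> :: "real ^ 'n \<Rightarrow> real ^ 'n"
    and qp :: "(real ^ 'n) list \<Rightarrow> real ^ 'n \<Rightarrow> real list"
    and N :: "real ^ 'n \<Rightarrow> real \<Rightarrow> nat"
    and s1 :: "real ^ 'n"
    and f :: "nat \<Rightarrow> real ^ 'n"
    and \<alpha> R F C c c' :: real
    and T :: nat
  assumes "compact \<K>" and "\<K> \<noteq> {}" and "\<K> \<subseteq> nonneg_orthant"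
    and "compact \<F>" and "\<F> \<subseteq> nonneg_orthant"
    and "R > 0" and "\<forall>x\<in>\<K>. norm x \<le> R"
    and "F > 0" and "\<forall>g\<in>\<F>. norm g \<le> F"
    and "C > 0" and "\<forall>x\<in>\<K>. \<forall>g\<in>\<F>. 0 \<le> x \<bullet> g \<and> x \<bullet> g \<le> C"
    and "\<alpha> > 0"
    and "approx_oracle \<alpha> \<K> \<O>"
    and "\<forall>vs x. vs \<noteq> [] \<longrightarrow> optimal_weights vs x (qp vs x)"
    and "c \<ge> 16" and "iteration_count c c' \<alpha> R N"
    and "T > 0"
    and "\<forall>t<T. f t \<in> \<F>"
    and "s1 \<in> \<K>"
  shows
    "(\<forall>\<eta> \<epsilon>. 0 < \<eta> \<and> 0 < \<epsilon> \<and> \<epsilon> \<le> (\<alpha> + 2) * R \<longrightarrow>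
        (let run = full_information \<alpha> R \<O> qp N s1 f \<eta> \<epsilon> T
         in lossless_spmf run \<and>
            expected_regret \<alpha> \<K> T f run \<le> \<alpha>\<^sup>2 * R\<^sup>2 / (real T * \<eta>) + \<eta> * F\<^sup>2 / 2 + 3 * F * \<epsilon> \<and>
            average_calls_le T run
              (16 * c' * ((1 + (\<eta> * \<alpha> * R * F + \<eta>\<^sup>2 * F\<^sup>2) / \<epsilon>\<^sup>2)
                 * (real CARD('n))\<^sup>2 * max 1 (ln ((\<alpha> + 1) * R / \<epsilon>)))))) \<and>
     (let \<eta> = \<alpha> * R * real T powr (- 2 / 3) / F;
          \<epsilon> = \<alpha> * R * real T powr (- 1 / 3);
          run = full_information \<alpha> R \<O> qp N s1 f \<eta> \<epsilon> T
      in expected_regret \<alpha> \<K> T f run \<le> 5 * (\<alpha> * R * F * real T powr (- 1 / 3)) \<and>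
         average_calls_le T run
           (48 * c' * ((real CARD('n))\<^sup>2 * max 1 (ln ((\<alpha> + 1) / \<alpha> * real T))))) \<and>
     (let \<eta> = \<alpha> * R * real T powr (- 1 / 2) / F;
          \<epsilon> = \<alpha> * R * real T powr (- 1 / 2);
          run = full_information \<alpha> R \<O> qp N s1 f \<eta> \<epsilon> T
      in expected_regret \<alpha> \<K> T f run \<le> 5 * (\<alpha> * R * F * real T powr (- 1 / 2)) \<and>
         average_calls_le T run
           (48 * c' * (sqrt (real T) * (real CARD('n))\<^sup>2 * max 1 (ln ((\<alpha> + 1) / \<alpha> * real T)))))"
proof -
  interpret online_problem \<alpha> R \<K> \<O> qp N c c'
    by (rule online_problem.intro) (use assms(2,3,6,7,12-16) in blast)+
  have f: "\<forall>t<T. f t \<in> nonneg_orthant \<and> norm (f t) \<le> F"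
    using assms(5,9,18) by blast
  have T1: "1 \<le> real T" using \<open>T > 0\<close> by simp
  have "real T powr (- 1 / 2) = real T powr - (1 / 2)" by simp
  also have "\<dots> = inverse (real T powr (1 / 2))" by (rule powr_minus)
  also have "\<dots> = 1 / sqrt (real T)" by (subst powr_half_sqrt) (simp_all add: inverse_eq_divide)
  finally have T_sqrt: "real T powr (- 1 / 2) = 1 / sqrt (real T)" .
  have small: "real T powr a \<le> 1" if "a \<le> 0" for a
    using powr_mono[OF that T1] T1 by simp
  have cube: "real T * real T powr (- 2 / 3) * real T powr (- 1 / 3) = 1"
  proof -
    have "real T * real T powr (- 2 / 3) * real T powr (- 1 / 3) = real T powr (1 + - 2 / 3 + - 1 / 3)"
      using T1 by (simp only: powr_add powr_one)
    then show ?thesis using T1 by simp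
  qed
  have square: "real T * real T powr (- 1 / 2) * real T powr (- 1 / 2) = 1"
    unfolding T_sqrt using T1 by simp
  have ratio: "real T powr (- 2 / 3) / (real T powr (- 1 / 3))\<^sup>2 \<le> 1"
  proof -
    have "(real T powr (- 1 / 3))\<^sup>2 = real T powr (- 1 / 3 + - 1 / 3)"
      by (simp only: powr_add power2_eq_square)
    then show ?thesis by simp
  qed
  have ratio': "real T powr (- 1 / 2) / (real T powr (- 1 / 2))\<^sup>2 \<le> sqrt (real T)"
    unfolding T_sqrt using T1 by (simp add: power_divide real_div_sqrt)
  have le: "real T powr (- 2 / 3) \<le> real T powr (- 1 / 3)"
    using T1 by (intro powr_mono) auto
  \<comment> \<open>Here h / \<open>u\<^sup>2\<close> equals 1, so K is 1. The second choice has h =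
    u, where the ratio is 1 / u, the square root of T.\<close>
  from full_information_tuned[OF \<open>s1 \<in> \<K>\<close> \<open>T > 0\<close> \<open>F > 0\<close> f _ _ le cube small _ ratio]
  have A: "expected_regret \<alpha> \<K> T f (full_information \<alpha> R \<O> qp N s1 f
        (\<alpha> * R * real T powr (- 2 / 3) / F) (\<alpha> * R * real T powr (- 1 / 3)) T)
      \<le> 5 * (\<alpha> * R * F * real T powr (- 1 / 3))"
    "average_calls_le T (full_information \<alpha> R \<O> qp N s1 f
        (\<alpha> * R * real T powr (- 2 / 3) / F) (\<alpha> * R * real T powr (- 1 / 3)) T)
      (48 * c' * ((real CARD('n))\<^sup>2 * max 1 (ln ((\<alpha> + 1) / \<alpha> * real T))))"
    using T1 by simp_all
  from full_information_tuned[OF \<open>s1 \<in> \<K>\<close> \<open>T > 0\<close> \<open>F > 0\<close> f _ _ order_refl square small _ ratio']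
  have B: "expected_regret \<alpha> \<K> T f (full_information \<alpha> R \<O> qp N s1 f
        (\<alpha> * R * real T powr (- 1 / 2) / F) (\<alpha> * R * real T powr (- 1 / 2)) T)
      \<le> 5 * (\<alpha> * R * F * real T powr (- 1 / 2))"
    "average_calls_le T (full_information \<alpha> R \<O> qp N s1 f
        (\<alpha> * R * real T powr (- 1 / 2) / F) (\<alpha> * R * real T powr (- 1 / 2)) T)
      (48 * c' * (sqrt (real T) * (real CARD('n))\<^sup>2 * max 1 (ln ((\<alpha> + 1) / \<alpha> * real T))))"
    using T1 by simp_all
  show ?thesis
    unfolding Let_def
    using full_information_bounds[OF \<open>s1 \<in> \<K>\<close> _ _ \<open>T > 0\<close> \<open>F > 0\<close> f] A B by blast
qed

end
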